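(* Let $2<p,q<\infty$. For every pair of non-empty sets $I$ and $J$, the dual space $(\ell_p(I)\widehat{\otimes}_\pi \ell_q(J))^*$ has the $w^*$-Kadec-Klee property. In particular, the norm of $\ell_p(I)\widehat{\otimes}_\pi \ell_q(J)$ is strongly subdifferentiable.
   Context: All Banach spaces are real. $S_X$ denotes the unit sphere of $X$, and $X^*$ its topological dual. The projective tensor product $X\widehat{\otimes}_\pi Y$ is the completion of the algebraic tensor product $X\otimes Y$ under the norm $\|z\|_\pi=\inf\{\sum_{i=1}^n\|x_i\|\|y_i\|: z=\sum_{i=1}^n x_i\otimes y_i\}$. $w^*$-(sequential) Kadec-Klee property: the dual $X^*$ of a Banach space $X$ has the $w^*$-Kadec-Klee property (also called $w^*$-sequential Kadec-Klee property) if whenever $(x_n^* )$ is a sequence in $S_{X^*}$ converging in the weak-star topology $\sigma(X^*,X)$ to some $x^*\in S_{X^*}$, then $\|x_n^*-x^*\|\to 0$. Strong subdifferentiability: the norm of a Banach space $Z$ is strongly subdifferentiable if for every $z\in S_Z$ the one-sided limit $\lim_{t\to 0^+}\frac{\|z+th\|-\|z\|}{t}$ exists uniformly for $h\in S_Z$. *)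

theory Defs
  imports "HOL-Analysis.Analysis"
begin

text \<open>
  The space $\ell_p(I)$ depends on a real number $p$ and therefore cannot be a type of class
  \<open>real_normed_vector\<close>.  Real normed spaces are rendered as records with an explicit carrier;
  the record itself imposes no axioms, it only packages the data of the concrete spaces below.
\<close>

record 'v nspace =
  vcarrier :: "'v set"
  vzero :: 'v
  vadd :: "'v \<Rightarrow> 'v \<Rightarrow> 'v"
  vscale :: "real \<Rightarrow> 'v \<Rightarrow> 'v"
  vnorm :: "'v \<Rightarrow> real"

definition vdiff :: "'v nspace \<Rightarrow> 'v \<Rightarrow> 'v \<Rightarrow> 'v" where
  "vdiff X x y = vadd X x (vscale X (-1) y)"

definition vsphere :: "'v nspace \<Rightarrow> 'v set" where
  "vsphere X = {x \<in> vcarrier X. vnorm X x = 1}"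

subsection \<open>The spaces $\ell_p(I)$\<close>

text \<open>Families indexed by \<open>I\<close> are functions vanishing outside \<open>I\<close>.\<close>

definition lp_space :: "real \<Rightarrow> 'i set \<Rightarrow> ('i \<Rightarrow> real) nspace" where
  "lp_space p I = \<lparr>
     vcarrier = {x. (\<forall>i. i \<notin> I \<longrightarrow> x i = 0) \<and> (\<lambda>i. \<bar>x i\<bar> powr p) summable_on I},
     vzero = (\<lambda>i. 0),
     vadd = (\<lambda>x y i. x i + y i),
     vscale = (\<lambda>c x i. c * x i),
     vnorm = (\<lambda>x. (\<Sum>\<^sub>\<infinity>i\<in>I. \<bar>x i\<bar> powr p) powr (1 / p)) \<rparr>"

subsection \<open>Dual space and weak-star topology\<close>

definition linear_form :: "'v nspace \<Rightarrow> ('v \<Rightarrow> real) \<Rightarrow> bool" where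
  "linear_form X f \<longleftrightarrow>
     (\<forall>x\<in>vcarrier X. \<forall>y\<in>vcarrier X. f (vadd X x y) = f x + f y) \<and>
     (\<forall>c. \<forall>x\<in>vcarrier X. f (vscale X c x) = c * f x)"

text \<open>A functional on \<open>X\<close> is made into a unique HOL function by setting it to 0 off the carrier.\<close>

definition dual_space :: "'v nspace \<Rightarrow> ('v \<Rightarrow> real) nspace" where
  "dual_space X = \<lparr>
     vcarrier = {f. linear_form X f \<and> (\<exists>C. \<forall>x\<in>vcarrier X. \<bar>f x\<bar> \<le> C * vnorm X x) \<and>
                    (\<forall>x. x \<notin> vcarrier X \<longrightarrow> f x = 0)},
     vzero = (\<lambda>x. 0),
     vadd = (\<lambda>f g x. f x + g x),
     vscale = (\<lambda>c f x. c * f x),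
     vnorm = (\<lambda>f. SUP x \<in> {x \<in> vcarrier X. vnorm X x \<le> 1}. \<bar>f x\<bar>) \<rparr>"

text \<open>The topology $\sigma(X^*, X)$: the initial topology for the evaluations at points of \<open>X\<close>.\<close>

definition weak_star_topology :: "'v nspace \<Rightarrow> ('v \<Rightarrow> real) topology" where
  "weak_star_topology X = topology_generated_by
     {{f \<in> vcarrier (dual_space X). f x \<in> U} | x U. x \<in> vcarrier X \<and> open U}"

definition dual_weak_star_Kadec_Klee :: "'v nspace \<Rightarrow> bool" where
  "dual_weak_star_Kadec_Klee X \<longleftrightarrow>
     (\<forall>(f :: nat \<Rightarrow> 'v \<Rightarrow> real) g.
        (\<forall>n. f n \<in> vsphere (dual_space X)) \<longrightarrow> g \<in> vsphere (dual_space X) \<longrightarrow>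
        limitin (weak_star_topology X) f g sequentially \<longrightarrow>
        (\<lambda>n. vnorm (dual_space X) (vdiff (dual_space X) (f n) g)) \<longlonglongrightarrow> 0)"

subsection \<open>Strong subdifferentiability of the norm\<close>

definition strongly_subdifferentiable_norm :: "'v nspace \<Rightarrow> bool" where
  "strongly_subdifferentiable_norm X \<longleftrightarrow>
     (\<forall>z\<in>vsphere X. \<exists>L.
        uniform_limit (vsphere X)
          (\<lambda>t h. (vnorm X (vadd X z (vscale X t h)) - vnorm X z) / t) L (at_right 0))"

subsection \<open>Completion\<close>

definition cauchy_seqs :: "'v nspace \<Rightarrow> (nat \<Rightarrow> 'v) set" where
  "cauchy_seqs X = {s. (\<forall>n. s n \<in> vcarrier X) \<and>
     (\<forall>e>0. \<exists>N. \<forall>m\<ge>N. \<forall>n\<ge>N. vnorm X (vdiff X (s m) (s n)) < e)}"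

definition cauchy_rel :: "'v nspace \<Rightarrow> ((nat \<Rightarrow> 'v) \<times> (nat \<Rightarrow> 'v)) set" where
  "cauchy_rel X = {(s, t). s \<in> cauchy_seqs X \<and> t \<in> cauchy_seqs X \<and>
     (\<lambda>n. vnorm X (vdiff X (s n) (t n))) \<longlonglongrightarrow> 0}"

text \<open>
  The operations act on representatives; the unions are over families of equal classes
  (the usual idiom of \<open>Equiv_Relations\<close>).
\<close>

definition completion :: "'v nspace \<Rightarrow> (nat \<Rightarrow> 'v) set nspace" where
  "completion X = \<lparr>
     vcarrier = cauchy_seqs X // cauchy_rel X,
     vzero = cauchy_rel X `` {\<lambda>n. vzero X},
     vadd = (\<lambda>A B. \<Union>s\<in>A. \<Union>t\<in>B. cauchy_rel X `` {\<lambda>n. vadd X (s n) (t n)}),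
     vscale = (\<lambda>c A. \<Union>s\<in>A. cauchy_rel X `` {\<lambda>n. vscale X c (s n)}),
     vnorm = (\<lambda>A. THE r. \<forall>s\<in>A. (\<lambda>n. vnorm X (s n)) \<longlonglongrightarrow> r) \<rparr>"

subsection \<open>Projective tensor product\<close>

definition bilinear_form :: "'v nspace \<Rightarrow> 'w nspace \<Rightarrow> ('v \<Rightarrow> 'w \<Rightarrow> real) \<Rightarrow> bool" where
  "bilinear_form X Y B \<longleftrightarrow>
     (\<forall>x\<in>vcarrier X. linear_form Y (B x)) \<and> (\<forall>y\<in>vcarrier Y. linear_form X (\<lambda>x. B x y))"

text \<open>
  As in Ryan's \<^emph>\<open>Introduction to Tensor Products of Banach Spaces\<close>, the algebraic tensor product
  is the span of the functionals $x \otimes y : B \mapsto B(x, y)$ on the space of all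
  (not necessarily bounded) bilinear forms.  \<open>tensor_sum X Y zs\<close> is
  $\sum_{i=1}^n x_i \otimes y_i$ for the list \<open>zs\<close> of the pairs $(x_i, y_i)$; coefficients can be
  absorbed into the $x_i$.
\<close>

definition tensor_sum ::
  "'v nspace \<Rightarrow> 'w nspace \<Rightarrow> ('v \<times> 'w) list \<Rightarrow> ('v \<Rightarrow> 'w \<Rightarrow> real) \<Rightarrow> real" where
  "tensor_sum X Y zs = (\<lambda>B. if bilinear_form X Y B then (\<Sum>(x, y)\<leftarrow>zs. B x y) else 0)"

definition tensor_reps ::
  "'v nspace \<Rightarrow> 'w nspace \<Rightarrow> (('v \<Rightarrow> 'w \<Rightarrow> real) \<Rightarrow> real) \<Rightarrow> ('v \<times> 'w) list set" where
  "tensor_reps X Y u = {zs. set zs \<subseteq> vcarrier X \<times> vcarrier Y \<and> u = tensor_sum X Y zs}"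

definition alg_tensor_pi ::
  "'v nspace \<Rightarrow> 'w nspace \<Rightarrow> (('v \<Rightarrow> 'w \<Rightarrow> real) \<Rightarrow> real) nspace" where
  "alg_tensor_pi X Y = \<lparr>
     vcarrier = {u. tensor_reps X Y u \<noteq> {}},
     vzero = (\<lambda>B. 0),
     vadd = (\<lambda>u v B. u B + v B),
     vscale = (\<lambda>c u B. c * u B),
     vnorm = (\<lambda>u. INF zs \<in> tensor_reps X Y u. (\<Sum>(x, y)\<leftarrow>zs. vnorm X x * vnorm Y y)) \<rparr>"

definition proj_tensor ::
  "'v nspace \<Rightarrow> 'w nspace \<Rightarrow> (nat \<Rightarrow> ('v \<Rightarrow> 'w \<Rightarrow> real) \<Rightarrow> real) set nspace" where
  "proj_tensor X Y = completion (alg_tensor_pi X Y)"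

end

theory Submission
  imports Defs "HOL-Library.Function_Algebras"
begin

text \<open>
  Write \<open>\<pi>\<close> for the projective norm. Everything follows from one property of it: for every \<open>e > 0\<close> there is
  \<open>r > 0\<close> such that for each \<open>z\<close> in the unit ball, every \<open>h\<close> in the unit ball differs from some
  element \<open>k\<close> of a finite set by a vector with \<open>\<pi> (z \<plusminus> r (h - k)) \<le> 1 + e r\<close>.

  For elementary tensors, \<open>2 (x \<otimes> y + s t (a \<otimes> b)) = (x + s a) \<otimes> (y + t b) + (x - s a) \<otimes> (y - t b)\<close>.
  If \<open>y\<close> and \<open>b\<close> have disjoint supports, then \<open>\<parallel>y \<plusminus> t b\<parallel> \<le> 1 + t powr q\<close>, while
  \<open>\<parallel>x + s a\<parallel> + \<parallel>x - s a\<parallel> \<le> 2 + C s\<^sup>2\<close>; as \<open>q > 2\<close>, suitable \<open>s\<close> and \<open>t\<close> bound the norm by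
  \<open>1 + e s t\<close>. The roles of the factors can be exchanged because \<open>p > 2\<close>. Up to a small error \<open>z\<close> lives on
  a finite rectangle \<open>F \<times> G\<close>, and \<open>h\<close> is the sum of its restriction to \<open>F \<times> G\<close>, which ranges over a bounded
  subset of a finite-dimensional space, and of tensors with one factor supported off \<open>F\<close> or \<open>G\<close>.

  A functional of norm one that almost attains its norm at \<open>z\<close> is therefore determined up to a small error
  by its values on a finite set, which turns weak-star convergence into norm convergence. By convexity, the
  difference quotients of the norm at \<open>z\<close> in the directions \<open>h\<close> and \<open>k\<close> are close for small parameters, so their
  convergence for the finitely many \<open>k\<close> is uniform in \<open>h\<close>. Neither argument needs compactness of the
  dual ball or the Hahn-Banach theorem.
\<close>

text \<open>Families, tensors (functionals on bilinear forms) and Cauchy sequences are all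
  functions, so the pointwise structure makes each carrier a \<open>subspace\<close> in the sense of
  one type class.\<close>

instantiation "fun" :: (type, real_vector) real_vector
begin

definition scaleR_fun :: "real \<Rightarrow> ('a \<Rightarrow> 'b) \<Rightarrow> 'a \<Rightarrow> 'b" where
  "scaleR_fun c f = (\<lambda>x. c *\<^sub>R f x)"

instance
  by standard (simp_all add: scaleR_fun_def fun_eq_iff scaleR_add_right scaleR_add_left)

end

lemma scaleR_fun_apply [simp]: "(c *\<^sub>R f) x = c *\<^sub>R f x"
  by (simp add: scaleR_fun_def)

section \<open>Asymptotic uniform smoothness\<close>

text \<open>A seminorm rather than a norm, so that Cauchy sequences under the limit of norms, where
  null sequences have value 0, form an instance before any quotient is taken.\<close>

locale seminormed =
  fixes S :: "'a::real_vector set" and N :: "'a \<Rightarrow> real"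
  assumes subspace: "subspace S"
    and triangle: "x \<in> S \<Longrightarrow> y \<in> S \<Longrightarrow> N (x + y) \<le> N x + N y"
    and scale: "x \<in> S \<Longrightarrow> N (c *\<^sub>R x) = \<bar>c\<bar> * N x"
begin

lemma add_mem [simp, intro]: "x \<in> S \<Longrightarrow> y \<in> S \<Longrightarrow> x + y \<in> S"
  and diff_mem [simp, intro]: "x \<in> S \<Longrightarrow> y \<in> S \<Longrightarrow> x - y \<in> S"
  and scale_mem [simp, intro]: "x \<in> S \<Longrightarrow> c *\<^sub>R x \<in> S"
  and zero_mem [simp, intro]: "0 \<in> S"
  using subspace by (auto simp: subspace_add subspace_diff subspace_scale subspace_0)

lemma N_zero [simp]: "N 0 = 0"
  using scale[of 0 0] by simp

lemma N_minus: "x \<in> S \<Longrightarrow> N (- x) = N x"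
  using scale[of x "-1"] by simp

lemma N_diff_commute: "x \<in> S \<Longrightarrow> y \<in> S \<Longrightarrow> N (x - y) = N (y - x)"
  using N_minus[of "x - y"] by simp

lemma N_nonneg: "x \<in> S \<Longrightarrow> 0 \<le> N x"
  using triangle[of x "- x"] N_minus[of x] subspace_neg[OF subspace, of x] by simp

lemma N_diff_ge: "x \<in> S \<Longrightarrow> y \<in> S \<Longrightarrow> N x - N y \<le> N (x - y)"
  using triangle[of "x - y" y] by simp

lemma N_abs_diff_le: "x \<in> S \<Longrightarrow> y \<in> S \<Longrightarrow> \<bar>N x - N y\<bar> \<le> N (x - y)"
  using N_diff_ge[of x y] N_diff_ge[of y x] N_diff_commute[of x y] by simp

lemma N_convex:
  assumes "x \<in> S" "u \<in> S" "0 \<le> t" "t \<le> r" "0 < r"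
  shows "N (x + t *\<^sub>R u) \<le> N x + (t / r) * (N (x + r *\<^sub>R u) - N x)"
proof -
  have "x + t *\<^sub>R u = (1 - t / r) *\<^sub>R x + (t / r) *\<^sub>R (x + r *\<^sub>R u)"
    using assms by (simp add: algebra_simps)
  then have "N (x + t *\<^sub>R u) \<le> \<bar>1 - t / r\<bar> * N x + \<bar>t / r\<bar> * N (x + r *\<^sub>R u)"
    using triangle[of "(1 - t / r) *\<^sub>R x" "(t / r) *\<^sub>R (x + r *\<^sub>R u)"] assms
    by (simp add: scale)
  then show ?thesis
    using assms by (simp add: algebra_simps)
qed

text \<open>The finite set \<open>K\<close> replaces the subspace of finite codimension in the usual definition of
  asymptotic uniform smoothness: it is a net of the bounded part of a complement.\<close>

definition smoothing_net :: "real \<Rightarrow> real \<Rightarrow> 'a \<Rightarrow> 'a set \<Rightarrow> bool" where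
  "smoothing_net e r z K \<longleftrightarrow> finite K \<and> K \<subseteq> S \<and> (\<forall>h\<in>S. N h \<le> 1 \<longrightarrow>
     (\<exists>k\<in>K. N (z + r *\<^sub>R (h - k)) \<le> 1 + e * r \<and> N (z - r *\<^sub>R (h - k)) \<le> 1 + e * r))"

text \<open>The radius \<open>r\<close> precedes \<open>z\<close>: later the base point is chosen to
  an accuracy depending on \<open>r\<close>, both when it nearly norms a functional and when it
  approximates an element of the completion.\<close>

definition asymptotically_smooth :: bool where
  "asymptotically_smooth \<longleftrightarrow>
     (\<forall>e>0. \<exists>r>0. \<forall>z\<in>S. N z \<le> 1 \<longrightarrow> (\<exists>K. smoothing_net e r z K))"

lemma smoothing_netE:
  assumes "smoothing_net e r z K" "h \<in> S" "N h \<le> 1"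
  obtains k where "k \<in> K" "k \<in> S"
    "N (z + r *\<^sub>R (h - k)) \<le> 1 + e * r" "N (z - r *\<^sub>R (h - k)) \<le> 1 + e * r"
  using assms unfolding smoothing_net_def by blast

section \<open>Difference quotients of the norm and strong subdifferentiability\<close>

text \<open>From the base point \<open>z + t k\<close> the norm grows by at most
  \<open>2 * e * r\<close> over the full step \<open>r (h - k)\<close>; convexity scales this growth
  down to the step \<open>t (h - k)\<close>, which ends at \<open>z + t h\<close>.\<close>

lemma directional_quotient_close:
  assumes mem: "z \<in> S" "h \<in> S" "k \<in> S" and "N z = 1" "N h \<le> M" "N k \<le> M"
    and t: "0 < t" "t \<le> r" "2 * t * M \<le> e * r"
    and bound: "N (z + r *\<^sub>R (h - k)) \<le> 1 + e * r"
  shows "N (z + t *\<^sub>R h) - N (z + t *\<^sub>R k) \<le> 2 * e * t"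
proof -
  let ?w = "z + t *\<^sub>R k"
  have tk: "t * N k \<le> t * M"
    using t \<open>N k \<le> M\<close> by simp
  have far: "N (?w + r *\<^sub>R (h - k)) \<le> N (z + r *\<^sub>R (h - k)) + t * N k"
    using triangle[of "z + r *\<^sub>R (h - k)" "t *\<^sub>R k"] mem t
    by (simp add: scale algebra_simps)
  have "1 - t * N k \<le> N ?w"
    using triangle[of ?w "- (t *\<^sub>R k)"] N_minus[of "t *\<^sub>R k"]
      subspace_neg[OF subspace, of "t *\<^sub>R k"] mem t \<open>N z = 1\<close>
    by (simp add: scale)
  \<comment> \<open>Replacing \<open>z\<close> by \<open>z + t k\<close> costs
    \<open>t * N k\<close> at either end. Together this is at most
    \<open>2 * t * M \<le> e * r\<close>, on top of the \<open>e * r\<close> in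
    \<open>bound\<close>.\<close>
  with far bound t tk have "N (?w + r *\<^sub>R (h - k)) - N ?w \<le> 2 * e * r"
    by linarith
  then have slope: "(t / r) * (N (?w + r *\<^sub>R (h - k)) - N ?w) \<le> (t / r) * (2 * e * r)"
    using t by (intro mult_left_mono) simp_all
  have "N (z + t *\<^sub>R h) = N (?w + t *\<^sub>R (h - k))"
    by (simp add: algebra_simps)
  also have "\<dots> \<le> N ?w + (t / r) * (N (?w + r *\<^sub>R (h - k)) - N ?w)"
    using mem t by (intro N_convex) auto
  also have "\<dots> \<le> N ?w + (t / r) * (2 * e * r)"
    using slope by simp
  finally show ?thesis
    using t by (simp add: mult_ac)
qed

lemma directional_quotient_mono:
  assumes "z \<in> S" "h \<in> S" "0 < t" "t \<le> s"
  shows "(N (z + t *\<^sub>R h) - N z) / t \<le> (N (z + s *\<^sub>R h) - N z) / s"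
  using N_convex[of z h t s] assms by (simp add: field_simps)

lemma directional_quotient_lower:
  assumes "z \<in> S" "h \<in> S" "0 < t"
  shows "- N h \<le> (N (z + t *\<^sub>R h) - N z) / t"
  using N_diff_ge[of z "z + t *\<^sub>R h"] N_minus[of "t *\<^sub>R h"] scale[of h t] assms
  by (simp add: field_simps)

text \<open>By convexity the quotients increase with \<open>t\<close>, and \<open>- N h\<close>
  bounds them below, so they tend to their infimum.\<close>

lemma directional_derivative_exists:
  assumes "z \<in> S" "h \<in> S"
  shows "\<exists>l. ((\<lambda>t. (N (z + t *\<^sub>R h) - N z) / t) \<longlongrightarrow> l) (at_right 0)"
proof -
  let ?f = "\<lambda>t. (N (z + t *\<^sub>R h) - N z) / t"
  define l where "l = (INF t\<in>{0<..}. ?f t)"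
  have bdd: "bdd_below (?f ` {0<..})"
    using directional_quotient_lower[OF assms] by (intro bdd_belowI[of _ "- N h"]) auto
  have "(?f \<longlongrightarrow> l) (at_right 0)"
  proof (rule order_tendstoI)
    fix a assume "a < l"
    moreover have "l \<le> ?f t" if "0 < t" for t
      unfolding l_def using that bdd by (intro cINF_lower) auto
    ultimately show "\<forall>\<^sub>F t in at_right 0. a < ?f t"
      unfolding eventually_at_right_field by (meson less_le_trans zero_less_one)
  next
    fix a assume "l < a"
    then obtain s where s: "0 < s" "?f s < a"
      unfolding l_def using bdd by (subst (asm) cINF_less_iff) auto
    then show "\<forall>\<^sub>F t in at_right 0. ?f t < a"
      unfolding eventually_at_right_field
      using directional_quotient_mono[OF assms]
      by (intro exI[of _ s]) (auto intro: le_less_trans[OF _ s(2)])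
  qed
  then show ?thesis by blast
qed

lemma asymptotically_smooth_imp_strongly_subdifferentiable:
  assumes smooth: "asymptotically_smooth" and z: "z \<in> S" "N z = 1"
  shows "\<exists>L. uniform_limit {h \<in> S. N h = 1} (\<lambda>t h. (N (z + t *\<^sub>R h) - N z) / t) L (at_right 0)"
proof -
  let ?f = "\<lambda>t h. (N (z + t *\<^sub>R h) - N z) / t"
  obtain L where L: "((\<lambda>t. ?f t h) \<longlongrightarrow> L h) (at_right 0)" if "h \<in> S" for h
    using directional_derivative_exists[OF z(1)] by metis
  have "uniform_limit {h \<in> S. N h = 1} ?f L (at_right 0)"
  proof (rule uniform_limitI)
    fix e :: real assume "0 < e"
    \<comment> \<open>Two quotients in direction \<open>h\<close> will differ by at most
      \<open>6 * d\<close>: \<open>2 * d\<close> twice for the passage between \<open>h\<close> and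
      a net point \<open>k\<close>, and \<open>d\<close> twice for the distance to
      \<open>L k\<close>.\<close>
    define d where "d = e / 8"
    have d: "0 < d" using \<open>0 < e\<close> by (simp add: d_def)
    obtain r K where r: "0 < r" and net: "smoothing_net d r z K"
      using smooth d z unfolding asymptotically_smooth_def by (metis order_refl)
    then have K: "finite K" "K \<subseteq> S"
      by (simp_all add: smoothing_net_def)
    \<comment> \<open>The 1 makes \<open>M\<close> a bound for \<open>N h = 1\<close> as well as for
      the finitely many \<open>N k\<close>.\<close>
    define M where "M = Max (insert 1 (N ` K))"
    have M: "1 \<le> M" "\<And>k. k \<in> K \<Longrightarrow> N k \<le> M"
      unfolding M_def using K(1) by auto
    have "\<forall>\<^sub>F t in at_right 0. \<forall>k\<in>K. dist (?f t k) (L k) < d"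
      using K(1,2) L d by (intro eventually_ball_finite ballI tendstoD) auto
    moreover have "\<forall>\<^sub>F t in at_right 0. t < min r (d * r / (2 * M))"
      using r d M(1) by (intro order_tendstoD(2)[OF tendsto_ident_at]) auto
    moreover have "\<forall>\<^sub>F t in at_right (0::real). 0 < t"
      by (simp add: eventually_at_right_less)
    ultimately have "\<forall>\<^sub>F t in at_right 0. 0 < t \<and> t < min r (d * r / (2 * M)) \<and> (\<forall>k\<in>K. dist (?f t k) (L k) < d)"
      by eventually_elim auto
    then obtain t0 where t0: "0 < t0" "\<And>t. 0 < t \<Longrightarrow> t < t0 \<Longrightarrow>
        t < min r (d * r / (2 * M)) \<and> (\<forall>k\<in>K. dist (?f t k) (L k) < d)"
      unfolding eventually_at_right_field by auto
    have close: "\<bar>?f t h - ?f s h\<bar> \<le> 6 * d"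
      if h: "h \<in> S" "N h = 1" and t: "0 < t" "t < t0" and s: "0 < s" "s < t0" for t s h
    proof -
      obtain k where k: "k \<in> K" "k \<in> S"
        "N (z + r *\<^sub>R (h - k)) \<le> 1 + d * r" "N (z - r *\<^sub>R (h - k)) \<le> 1 + d * r"
        using smoothing_netE[OF net, of h] h by auto
      \<comment> \<open>The lower sign in the net is the same estimate with \<open>h\<close> and
        \<open>k\<close> exchanged, which makes the comparison two-sided.\<close>
      then have k': "N (z + r *\<^sub>R (k - h)) \<le> 1 + d * r"
        by (simp add: algebra_simps)
      have near: "\<bar>?f u h - ?f u k\<bar> \<le> 2 * d" if "0 < u" "u < t0" for u
      proof -
        have u: "u < r" "2 * u * M \<le> d * r"
          using t0(2)[OF that] M(1) by (auto simp: field_simps)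
        have "N (z + u *\<^sub>R h) - N (z + u *\<^sub>R k) \<le> 2 * d * u"
          using h k k' z M u that by (intro directional_quotient_close[of z h k M u r d]) auto
        moreover have "N (z + u *\<^sub>R k) - N (z + u *\<^sub>R h) \<le> 2 * d * u"
          using h k k' z M u that by (intro directional_quotient_close[of z k h M u r d]) auto
        ultimately have "\<bar>N (z + u *\<^sub>R h) - N (z + u *\<^sub>R k)\<bar> \<le> 2 * d * u" by simp
        moreover have "?f u h - ?f u k = (N (z + u *\<^sub>R h) - N (z + u *\<^sub>R k)) / u"
          by (simp add: diff_divide_distrib)
        ultimately show ?thesis
          using that by (simp add: abs_divide pos_divide_le_eq)
      qed
      have "dist (?f t k) (L k) < d" "dist (?f s k) (L k) < d"
        using t0(2) t s k by auto
      with near[OF t] near[OF s] show ?thesis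
        by (simp add: dist_real_def)
    qed
    \<comment> \<open>Here \<open>s\<close> tends to 0 in \<open>close\<close> for fixed
      \<open>t\<close>. Since \<open>t0\<close> was fixed before \<open>h\<close>, the resulting
      rate is uniform.\<close>
    have "\<bar>?f t h - L h\<bar> \<le> 6 * d" if h: "h \<in> S" "N h = 1" and t: "0 < t" "t < t0" for t h
    proof -
      have "((\<lambda>s. \<bar>?f t h - ?f s h\<bar>) \<longlongrightarrow> \<bar>?f t h - L h\<bar>) (at_right 0)"
        using L[OF h(1)] by (intro tendsto_intros)
      moreover have "\<forall>\<^sub>F s in at_right 0. \<bar>?f t h - ?f s h\<bar> \<le> 6 * d"
        unfolding eventually_at_right_field using close[OF h t] t0(1) by blast
      ultimately show ?thesis
        by (rule tendsto_upperbound) simp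
    qed
    moreover have "6 * d < e"
      using \<open>0 < e\<close> by (simp add: d_def)
    ultimately show "\<forall>\<^sub>F t in at_right 0. \<forall>h\<in>{h \<in> S. N h = 1}. dist (?f t h) (L h) < e"
      unfolding eventually_at_right_field dist_real_def
      using t0(1) by (auto intro!: exI[of _ t0] intro: le_less_trans)
  qed
  then show ?thesis by blast
qed

section \<open>From pointwise to uniform convergence of functionals\<close>

text \<open>Once \<open>f n z\<close> is close to 1, the bound for \<open>f n\<close> at
  \<open>z \<plusminus> r (h - k)\<close> forces \<open>f n h\<close> and \<open>f n k\<close> to be
  close, so the values on the finite net control \<open>f n\<close> on the whole unit ball.\<close>

lemma asymptotically_smooth_imp_uniform_convergence:
  fixes f :: "nat \<Rightarrow> 'a \<Rightarrow> real"
  assumes smooth: "asymptotically_smooth" and "0 < e"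
    and f_add: "\<And>n x y. x \<in> S \<Longrightarrow> y \<in> S \<Longrightarrow> f n (x + y) = f n x + f n y"
    and f_scale: "\<And>n c x. x \<in> S \<Longrightarrow> f n (c *\<^sub>R x) = c * f n x"
    and f_bound: "\<And>n x. x \<in> S \<Longrightarrow> \<bar>f n x\<bar> \<le> N x"
    and f_lim: "\<And>x. x \<in> S \<Longrightarrow> (\<lambda>n. f n x) \<longlonglongrightarrow> g x"
    and g_norm: "\<And>d. 0 < d \<Longrightarrow> \<exists>z\<in>S. N z \<le> 1 \<and> 1 - d < g z"
  shows "\<forall>\<^sub>F n in sequentially. \<forall>h\<in>S. N h \<le> 1 \<longrightarrow> \<bar>f n h - g h\<bar> \<le> e"
proof -
  \<comment> \<open>The passage from \<open>h\<close> to \<open>k\<close> costs \<open>2 * d\<close>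
    under \<open>f n\<close> and \<open>2 * d\<close> under \<open>g\<close>, and the convergence at
    \<open>k\<close> costs \<open>d\<close>.\<close>
  define d where "d = e / 5"
  have d: "0 < d" using \<open>0 < e\<close> by (simp add: d_def)
  obtain r where r: "0 < r" and nets: "\<forall>z\<in>S. N z \<le> 1 \<longrightarrow> (\<exists>K. smoothing_net d r z K)"
    using smooth d unfolding asymptotically_smooth_def by blast
  \<comment> \<open>The error at \<open>z\<close> is divided by \<open>r\<close> in
    \<open>far\<close>, hence the accuracy \<open>d * r\<close>.\<close>
  obtain z where z: "z \<in> S" "N z \<le> 1" "1 - d * r < g z"
    using g_norm[of "d * r"] d r by auto
  then obtain K where net: "smoothing_net d r z K"
    using nets by blast
  then have K: "finite K" "K \<subseteq> S"
    by (simp_all add: smoothing_net_def)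
  have far: "\<bar>f n h - f n k\<bar> \<le> 2 * d"
    if "h \<in> S" "k \<in> S" and big: "1 - d * r < f n z"
      and bounds: "N (z + r *\<^sub>R (h - k)) \<le> 1 + d * r" "N (z - r *\<^sub>R (h - k)) \<le> 1 + d * r" for n h k
  proof -
    have "f n (h - k) = f n h - f n k"
      using f_add[of "h - k" k n] that by simp
    then have "f n (z + c *\<^sub>R (h - k)) = f n z + c * (f n h - f n k)" for c
      using f_add[of z "c *\<^sub>R (h - k)" n] f_scale[of "h - k" n c] z that by simp
    from this[of r] this[of "- r"]
    have "f n z + r * (f n h - f n k) \<le> 1 + d * r" "f n z - r * (f n h - f n k) \<le> 1 + d * r"
      using f_bound[of "z + r *\<^sub>R (h - k)" n] f_bound[of "z - r *\<^sub>R (h - k)" n] bounds z that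
      by (auto simp: algebra_simps)
    with big have "r * (f n h - f n k) \<le> r * (2 * d)" "r * (f n k - f n h) \<le> r * (2 * d)"
      by (auto simp: algebra_simps)
    then show ?thesis
      using r by (simp add: abs_le_iff)
  qed
  have "\<forall>\<^sub>F n in sequentially. \<forall>k\<in>K. dist (f n k) (g k) < d"
    using K(1,2) f_lim d by (intro eventually_ball_finite ballI tendstoD) auto
  moreover have ev: "\<forall>\<^sub>F n in sequentially. 1 - d * r < f n z"
    using f_lim[OF z(1)] z(3) by (rule order_tendstoD)
  ultimately show ?thesis
  proof eventually_elim
    case (elim n)
    show ?case
    proof (intro ballI impI)
      fix h assume h: "h \<in> S" "N h \<le> 1"
      obtain k where k: "k \<in> K" and kS: "k \<in> S"
        and bounds: "N (z + r *\<^sub>R (h - k)) \<le> 1 + d * r" "N (z - r *\<^sub>R (h - k)) \<le> 1 + d * r"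
        using smoothing_netE[OF net h] .
      \<comment> \<open>The estimate passes to \<open>g\<close>, the pointwise limit of the
        \<open>f m\<close>.\<close>
      have "(\<lambda>m. \<bar>f m h - f m k\<bar>) \<longlonglongrightarrow> \<bar>g h - g k\<bar>"
        using f_lim h kS by (intro tendsto_intros) auto
      moreover have "\<forall>\<^sub>F m in sequentially. \<bar>f m h - f m k\<bar> \<le> 2 * d"
        using ev by eventually_elim (use far h kS bounds in auto)
      ultimately have "\<bar>g h - g k\<bar> \<le> 2 * d"
        by (rule tendsto_upperbound) simp
      moreover have "\<bar>f n h - f n k\<bar> \<le> 2 * d"
        using far h kS bounds elim by auto
      moreover have "\<bar>f n k - g k\<bar> < d"
        using elim k by (auto simp: dist_real_def)
      ultimately show "\<bar>f n h - g h\<bar> \<le> e"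
        unfolding d_def abs_le_iff abs_less_iff by linarith
    qed
  qed
qed

end

section \<open>Cauchy sequences and the completion\<close>

context seminormed
begin

definition cauchys :: "(nat \<Rightarrow> 'a) set" where
  "cauchys = {s. (\<forall>n. s n \<in> S) \<and> (\<forall>e>0. \<exists>M. \<forall>m\<ge>M. \<forall>n\<ge>M. N (s m - s n) < e)}"

text \<open>This is the norm of the class of \<open>s\<close> in the completion. It is studied on
  the sequences themselves, where the vector operations are pointwise.\<close>

definition limN :: "(nat \<Rightarrow> 'a) \<Rightarrow> real" where
  "limN s = lim (\<lambda>n. N (s n))"

lemma cauchys_mem: "s \<in> cauchys \<Longrightarrow> s n \<in> S"
  by (simp add: cauchys_def)

lemma cauchysE:
  assumes "s \<in> cauchys" "0 < e"
  obtains M where "\<And>m n. M \<le> m \<Longrightarrow> M \<le> n \<Longrightarrow> N (s m - s n) < e"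
  using assms unfolding cauchys_def by blast

lemma limN_tendsto:
  assumes "s \<in> cauchys"
  shows "(\<lambda>n. N (s n)) \<longlonglongrightarrow> limN s"
proof -
  have "Cauchy (\<lambda>n. N (s n))"
  proof (rule metric_CauchyI)
    fix e :: real assume "0 < e"
    then obtain M where "\<And>m n. M \<le> m \<Longrightarrow> M \<le> n \<Longrightarrow> N (s m - s n) < e"
      using cauchysE[OF assms] by blast
    moreover have "dist (N (s m)) (N (s n)) \<le> N (s m - s n)" for m n
      using N_abs_diff_le cauchys_mem[OF assms] by (simp add: dist_real_def)
    ultimately show "\<exists>M. \<forall>m\<ge>M. \<forall>n\<ge>M. dist (N (s m)) (N (s n)) < e"
      by (meson le_less_trans)
  qed
  then show ?thesis
    unfolding limN_def by (simp add: Cauchy_convergent convergent_LIMSEQ_iff[symmetric])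
qed

lemma limN_eqI: "s \<in> cauchys \<Longrightarrow> (\<lambda>n. N (s n)) \<longlonglongrightarrow> l \<Longrightarrow> limN s = l"
  using LIMSEQ_unique limN_tendsto by blast

lemma const_cauchys: "a \<in> S \<Longrightarrow> (\<lambda>n. a) \<in> cauchys"
  by (simp add: cauchys_def)

lemma limN_const: "a \<in> S \<Longrightarrow> limN (\<lambda>n. a) = N a"
  by (intro limN_eqI const_cauchys) auto

lemma cauchys_add:
  assumes "s \<in> cauchys" "t \<in> cauchys"
  shows "s + t \<in> cauchys"
  unfolding cauchys_def
proof (intro CollectI conjI allI impI)
  show "(s + t) n \<in> S" for n
    using assms cauchys_mem by simp
  fix e :: real assume "0 < e"
  then have e2: "0 < e / 2" by simp
  obtain M1 where M1: "\<And>m n. M1 \<le> m \<Longrightarrow> M1 \<le> n \<Longrightarrow> N (s m - s n) < e / 2"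
    using cauchysE[OF assms(1) e2] by blast
  obtain M2 where M2: "\<And>m n. M2 \<le> m \<Longrightarrow> M2 \<le> n \<Longrightarrow> N (t m - t n) < e / 2"
    using cauchysE[OF assms(2) e2] by blast
  have "N ((s + t) m - (s + t) n) < e" if "max M1 M2 \<le> m" "max M1 M2 \<le> n" for m n
  proof -
    have "(s + t) m - (s + t) n = (s m - s n) + (t m - t n)"
      by simp
    also have "N \<dots> \<le> N (s m - s n) + N (t m - t n)"
      using assms by (intro triangle diff_mem cauchys_mem)
    finally have "N ((s + t) m - (s + t) n) \<le> N (s m - s n) + N (t m - t n)" .
    moreover have "N (s m - s n) < e / 2" "N (t m - t n) < e / 2"
      using M1[of m n] M2[of m n] that by auto
    ultimately show ?thesis by simp
  qed
  then show "\<exists>M. \<forall>m\<ge>M. \<forall>n\<ge>M. N ((s + t) m - (s + t) n) < e"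
    by blast
qed

lemma cauchys_scale:
  assumes "s \<in> cauchys"
  shows "c *\<^sub>R s \<in> cauchys"
  unfolding cauchys_def
proof (intro CollectI conjI allI impI)
  show "(c *\<^sub>R s) n \<in> S" for n
    using assms cauchys_mem by simp
  fix e :: real assume "0 < e"
  then have "0 < e / (\<bar>c\<bar> + 1)" by simp
  then obtain M where M: "\<And>m n. M \<le> m \<Longrightarrow> M \<le> n \<Longrightarrow> N (s m - s n) < e / (\<bar>c\<bar> + 1)"
    using cauchysE[OF assms] by blast
  have "N ((c *\<^sub>R s) m - (c *\<^sub>R s) n) < e" if "M \<le> m" "M \<le> n" for m n
  proof -
    have mem: "s m - s n \<in> S" using assms cauchys_mem by simp
    have "N ((c *\<^sub>R s) m - (c *\<^sub>R s) n) = \<bar>c\<bar> * N (s m - s n)"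
      using scale[OF mem, of c] by (simp add: scaleR_diff_right)
    also have "\<dots> \<le> (\<bar>c\<bar> + 1) * N (s m - s n)"
      using N_nonneg[OF mem] by (simp add: algebra_simps)
    also have "\<dots> < e"
      using M[OF that] by (simp add: field_simps)
    finally show ?thesis .
  qed
  then show "\<exists>M. \<forall>m\<ge>M. \<forall>n\<ge>M. N ((c *\<^sub>R s) m - (c *\<^sub>R s) n) < e"
    by blast
qed

lemma subspace_cauchys: "subspace cauchys"
  using cauchys_add cauchys_scale const_cauchys[OF zero_mem]
  by (auto simp: subspace_def zero_fun_def)

lemma limN_triangle:
  assumes "s \<in> cauchys" "t \<in> cauchys"
  shows "limN (s + t) \<le> limN s + limN t"
proof (rule tendsto_le)
  show "(\<lambda>n. N (s n) + N (t n)) \<longlonglongrightarrow> limN s + limN t" "(\<lambda>n. N ((s + t) n)) \<longlonglongrightarrow> limN (s + t)"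
    using assms by (auto intro!: tendsto_add limN_tendsto cauchys_add simp del: plus_fun_apply)
  show "\<forall>\<^sub>F n in sequentially. N ((s + t) n) \<le> N (s n) + N (t n)"
    using assms by (intro always_eventually allI) (simp add: triangle cauchys_mem)
qed simp

lemma limN_scale:
  assumes "s \<in> cauchys"
  shows "limN (c *\<^sub>R s) = \<bar>c\<bar> * limN s"
proof (intro limN_eqI cauchys_scale assms)
  have "(\<lambda>n. \<bar>c\<bar> * N (s n)) \<longlonglongrightarrow> \<bar>c\<bar> * limN s"
    by (intro tendsto_mult_left limN_tendsto assms)
  then show "(\<lambda>n. N ((c *\<^sub>R s) n)) \<longlonglongrightarrow> \<bar>c\<bar> * limN s"
    using assms by (simp add: scale cauchys_mem)
qed

lemma seminormed_cauchys: "seminormed cauchys limN"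
  by unfold_locales (simp_all add: subspace_cauchys limN_triangle limN_scale)

interpretation C: seminormed cauchys limN
  by (rule seminormed_cauchys)

text \<open>A late member of the sequence is within \<open>d / 2\<close> of the sequence and has
  norm at most \<open>1 + d / 2\<close>; dividing it by \<open>1 + d / 2\<close> brings it into the
  unit ball and moves it by at most another \<open>d / 2\<close>.\<close>

lemma cauchys_approx_const:
  assumes "s \<in> cauchys" "limN s \<le> 1" "0 < d"
  obtains a where "a \<in> S" "N a \<le> 1" "limN (s - (\<lambda>n. a)) \<le> d"
proof -
  have "0 < d / 2" using assms(3) by simp
  then obtain M where M: "\<And>m n. M \<le> m \<Longrightarrow> M \<le> n \<Longrightarrow> N (s m - s n) < d / 2"
    using cauchysE[OF assms(1)] by blast
  define a0 where "a0 = s M"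
  have a0: "a0 \<in> S" using assms by (simp add: a0_def cauchys_mem)
  have dist0: "limN (s - (\<lambda>n. a0)) \<le> d / 2"
  proof (rule tendsto_upperbound)
    show "(\<lambda>n. N ((s - (\<lambda>n. a0)) n)) \<longlonglongrightarrow> limN (s - (\<lambda>n. a0))"
      using assms a0 by (intro limN_tendsto C.diff_mem const_cauchys)
    show "\<forall>\<^sub>F n in sequentially. N ((s - (\<lambda>n. a0)) n) \<le> d / 2"
      using M by (auto simp: eventually_sequentially a0_def intro: less_imp_le)
  qed simp
  have N0: "N a0 \<le> 1 + d / 2"
    using C.N_diff_ge[of "\<lambda>n. a0" s] C.N_diff_commute[of s "\<lambda>n. a0"] dist0 assms a0
    by (simp add: const_cauchys limN_const)
  define a where "a = (1 / (1 + d / 2)) *\<^sub>R a0"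
  have aS: "a \<in> S" using a0 by (simp add: a_def)
  have "N a \<le> 1"
    using N0 assms a0 by (simp add: a_def scale pos_divide_le_eq)
  moreover have "N (a0 - a) \<le> d / 2"
  proof -
    have "a0 = (1 + d / 2) *\<^sub>R a"
      using assms by (simp add: a_def)
    then have "a0 - a = (d / 2) *\<^sub>R a"
      by (simp add: scaleR_add_left)
    then show ?thesis
      using \<open>N a \<le> 1\<close> scale[of a "d / 2"] a0 assms by (simp add: a_def)
  qed
  moreover have "limN (s - (\<lambda>n. a)) \<le> limN (s - (\<lambda>n. a0)) + N (a0 - a)"
  proof -
    have "s - (\<lambda>n. a) = (s - (\<lambda>n. a0)) + (\<lambda>n. a0 - a)"
      by (simp add: fun_eq_iff)
    then have "limN (s - (\<lambda>n. a)) = limN ((s - (\<lambda>n. a0)) + (\<lambda>n. a0 - a))"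
      by (rule arg_cong)
    also have "\<dots> \<le> limN (s - (\<lambda>n. a0)) + limN (\<lambda>n. a0 - a)"
      using a0 assms(1) by (intro limN_triangle C.diff_mem const_cauchys) (simp_all add: a_def)
    also have "limN (\<lambda>n. a0 - a) = N (a0 - a)"
      using a0 by (intro limN_const) (simp add: a_def)
    finally show ?thesis .
  qed
  ultimately have "N a \<le> 1" "limN (s - (\<lambda>n. a)) \<le> d"
    using dist0 by linarith+
  then show thesis
    using that[OF aS] by blast
qed

text \<open>Constant sequences stand in for \<open>z\<close> and \<open>h\<close>, and the nets of
  \<open>S\<close> are embedded as constants. Smoothing at tolerance \<open>e / 2\<close> leaves
  \<open>(e / 2) * r\<close> for the approximation errors.\<close>

lemma asymptotically_smooth_cauchys:
  assumes smooth: "asymptotically_smooth"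
  shows "C.asymptotically_smooth"
  unfolding C.asymptotically_smooth_def
proof (intro allI impI)
  fix e :: real assume "0 < e"
  then have e2: "0 < e / 2" by simp
  then obtain r where r: "0 < r" and nets: "\<forall>z\<in>S. N z \<le> 1 \<longrightarrow> (\<exists>K. smoothing_net (e / 2) r z K)"
    using smooth unfolding asymptotically_smooth_def by blast
  \<comment> \<open>Replacing \<open>z\<close> by \<open>a\<close> costs \<open>d\<close> and
    replacing \<open>h\<close> by \<open>b\<close> costs \<open>r * d\<close>; this choice makes the
    total exactly \<open>(e / 2) * r\<close>.\<close>
  define d where "d = (e / 2) * r / (1 + r)"
  have d: "0 < d"
    using r \<open>0 < e\<close> by (simp add: d_def)
  have "d * (1 + r) = (e / 2) * r"
    using iffD1[OF nonzero_eq_divide_eq d_def] r by simp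
  then have d_eq: "d + r * d = (e / 2) * r"
    by (simp add: algebra_simps)
  show "\<exists>r>0. \<forall>z\<in>cauchys. limN z \<le> 1 \<longrightarrow> (\<exists>K. C.smoothing_net e r z K)"
  proof (intro exI[of _ r] conjI r ballI impI)
    fix z assume z: "z \<in> cauchys" "limN z \<le> 1"
    obtain a where a: "a \<in> S" "N a \<le> 1" "limN (z - (\<lambda>n. a)) \<le> d"
      using cauchys_approx_const[OF z d] .
    obtain K where net: "smoothing_net (e / 2) r a K"
      using nets a by blast
    have "C.smoothing_net e r z ((\<lambda>k n. k) ` K)"
      unfolding C.smoothing_net_def
    proof (intro conjI ballI impI)
      show "finite ((\<lambda>k n. k) ` K)" "(\<lambda>k n. k) ` K \<subseteq> cauchys"
        using net const_cauchys by (auto simp: smoothing_net_def)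
      fix h assume h: "h \<in> cauchys" "limN h \<le> 1"
      obtain b where b: "b \<in> S" "N b \<le> 1" "limN (h - (\<lambda>n. b)) \<le> d"
        using cauchys_approx_const[OF h d] .
      obtain k where k: "k \<in> K" "k \<in> S"
        "N (a + r *\<^sub>R (b - k)) \<le> 1 + e / 2 * r" "N (a - r *\<^sub>R (b - k)) \<le> 1 + e / 2 * r"
        using smoothing_netE[OF net b(1,2)] .
      have bound: "limN (z + c *\<^sub>R (h - (\<lambda>n. k))) \<le> 1 + e * r"
        if "\<bar>c\<bar> = r" "N (a + c *\<^sub>R (b - k)) \<le> 1 + e / 2 * r" for c
      proof -
        have mem: "z - (\<lambda>n. a) \<in> cauchys" "(\<lambda>n. a + c *\<^sub>R (b - k)) \<in> cauchys" "h - (\<lambda>n. b) \<in> cauchys"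
          using z h a b k by (auto intro!: C.diff_mem const_cauchys)
        have "z + c *\<^sub>R (h - (\<lambda>n. k)) =
            (z - (\<lambda>n. a)) + ((\<lambda>n. a + c *\<^sub>R (b - k)) + c *\<^sub>R (h - (\<lambda>n. b)))"
          by (simp add: fun_eq_iff algebra_simps)
        then have "limN (z + c *\<^sub>R (h - (\<lambda>n. k))) \<le>
            limN (z - (\<lambda>n. a)) + limN ((\<lambda>n. a + c *\<^sub>R (b - k)) + c *\<^sub>R (h - (\<lambda>n. b)))"
          using C.triangle[OF mem(1) C.add_mem[OF mem(2) C.scale_mem[OF mem(3), of c]]] by (simp only:)
        moreover have "limN ((\<lambda>n. a + c *\<^sub>R (b - k)) + c *\<^sub>R (h - (\<lambda>n. b))) \<le>
            limN (\<lambda>n. a + c *\<^sub>R (b - k)) + limN (c *\<^sub>R (h - (\<lambda>n. b)))"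
          by (rule C.triangle[OF mem(2) C.scale_mem[OF mem(3)]])
        moreover have "limN (\<lambda>n. a + c *\<^sub>R (b - k)) = N (a + c *\<^sub>R (b - k))"
          using a b k by (intro limN_const) auto
        moreover have "limN (c *\<^sub>R (h - (\<lambda>n. b))) = r * limN (h - (\<lambda>n. b))"
          using C.scale[OF mem(3), of c] that(1) by simp
        moreover have "r * limN (h - (\<lambda>n. b)) \<le> r * d"
          using b(3) r by simp
        ultimately show ?thesis
          using a(3) that(2) d_eq by linarith
      qed
      have "limN (z + r *\<^sub>R (h - (\<lambda>n. k))) \<le> 1 + e * r"
        using bound[of r] k r by simp
      moreover have "limN (z - r *\<^sub>R (h - (\<lambda>n. k))) \<le> 1 + e * r"
        using bound[of "- r"] k r by simp
      ultimately show "\<exists>k\<in>(\<lambda>k n. k) ` K. limN (z + r *\<^sub>R (h - k)) \<le> 1 + e * r \<and> limN (z - r *\<^sub>R (h - k)) \<le> 1 + e * r"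
        using k(1) by blast
    qed
    then show "\<exists>K. C.smoothing_net e r z K" by blast
  qed
qed

end

section \<open>Cauchy sequences modulo null sequences\<close>

locale seminormed_nspace =
  fixes X :: "'v::real_vector nspace"
  assumes vadd_eq: "vadd X = (+)" and vscale_eq: "vscale X = (*\<^sub>R)"
    and seminormed: "seminormed (vcarrier X) (vnorm X)"
begin

sublocale seminormed "vcarrier X" "vnorm X"
  by (rule seminormed)

interpretation C: seminormed cauchys limN
  by (rule seminormed_cauchys)

lemma vdiff_eq: "vdiff X x y = x - y"
  by (simp add: vdiff_def vadd_eq vscale_eq)

lemma cauchy_seqs_eq: "cauchy_seqs X = cauchys"
  by (simp add: cauchy_seqs_def cauchys_def vdiff_eq)

lemma cauchy_rel_iff: "(s, t) \<in> cauchy_rel X \<longleftrightarrow> s \<in> cauchys \<and> t \<in> cauchys \<and> limN (s - t) = 0"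
proof -
  have "(\<lambda>n. vnorm X (s n - t n)) \<longlonglongrightarrow> 0 \<longleftrightarrow> limN (s - t) = 0" if "s \<in> cauchys" "t \<in> cauchys"
    using limN_tendsto[OF C.diff_mem[OF that]] limN_eqI[OF C.diff_mem[OF that], of 0]
    unfolding minus_apply by metis
  then show ?thesis
    unfolding cauchy_rel_def cauchy_seqs_eq vdiff_eq by blast
qed

lemma equiv_cauchy_rel: "equiv cauchys (cauchy_rel X)"
proof (rule equivI)
  show "cauchy_rel X \<subseteq> cauchys \<times> cauchys"
    by (auto simp: cauchy_rel_iff)
  show "refl_on cauchys (cauchy_rel X)"
    by (auto simp: refl_on_def cauchy_rel_iff)
  show "sym (cauchy_rel X)"
    by (auto simp: sym_def cauchy_rel_iff C.N_diff_commute)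
  show "trans (cauchy_rel X)"
  proof (rule transI)
    fix s t u assume "(s, t) \<in> cauchy_rel X" "(t, u) \<in> cauchy_rel X"
    then show "(s, u) \<in> cauchy_rel X"
      using C.triangle[of "s - t" "t - u"] C.N_nonneg[of "s - u"] by (auto simp: cauchy_rel_iff)
  qed
qed

definition cls :: "(nat \<Rightarrow> 'v) \<Rightarrow> (nat \<Rightarrow> 'v) set" where
  "cls s = cauchy_rel X `` {s}"

lemma vcarrier_completion: "vcarrier (completion X) = cls ` cauchys"
  by (auto simp: completion_def quotient_def cls_def cauchy_seqs_eq)

lemma cls_mem: "s \<in> cauchys \<Longrightarrow> s \<in> cls s"
  by (simp add: cls_def cauchy_rel_iff)

lemma in_clsD:
  assumes "t \<in> cls s"
  shows "s \<in> cauchys" "t \<in> cauchys" "limN (s - t) = 0" "cls t = cls s" "limN t = limN s"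
proof -
  show *: "s \<in> cauchys" "t \<in> cauchys" "limN (s - t) = 0"
    using assms by (auto simp: cls_def cauchy_rel_iff)
  show "cls t = cls s"
    using assms equiv_class_eq[OF equiv_cauchy_rel, of s t] by (auto simp: cls_def)
  show "limN t = limN s"
    using C.N_abs_diff_le[of s t] * by simp
qed

lemma cls_eqI: "s \<in> cauchys \<Longrightarrow> t \<in> cauchys \<Longrightarrow> limN (s - t) = 0 \<Longrightarrow> cls s = cls t"
  by (rule in_clsD(4)) (simp add: cls_def cauchy_rel_iff C.N_diff_commute)

lemma vnorm_completion:
  assumes "s \<in> cauchys"
  shows "vnorm (completion X) (cls s) = limN s"
  unfolding completion_def nspace.simps
proof (rule the_equality)
  show "\<forall>t\<in>cls s. (\<lambda>n. vnorm X (t n)) \<longlonglongrightarrow> limN s"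
    using in_clsD limN_tendsto by metis
  show "r = limN s" if "\<forall>t\<in>cls s. (\<lambda>n. vnorm X (t n)) \<longlonglongrightarrow> r" for r
    using that cls_mem[OF assms] limN_eqI[OF assms] by blast
qed

lemma vadd_completion:
  assumes "s \<in> cauchys" "t \<in> cauchys"
  shows "vadd (completion X) (cls s) (cls t) = cls (s + t)"
proof -
  \<comment> \<open>All pairs of representatives give the same class, so the union in
    \<open>vadd\<close> collapses to a single set.\<close>
  have eq: "cls (s' + t') = cls (s + t)" if "s' \<in> cls s" "t' \<in> cls t" for s' t'
  proof (rule cls_eqI)
    note mem = in_clsD[OF that(1)] in_clsD[OF that(2)]
    show "s' + t' \<in> cauchys" "s + t \<in> cauchys"
      using mem by auto
    have "(s' + t') - (s + t) = (s' - s) + (t' - t)" by simp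
    then have "limN ((s' + t') - (s + t)) \<le> limN (s' - s) + limN (t' - t)"
      using mem C.triangle by (metis C.diff_mem)
    then show "limN ((s' + t') - (s + t)) = 0"
      using mem C.N_nonneg[of "(s' + t') - (s + t)"] by (simp add: C.N_diff_commute)
  qed
  have "vadd (completion X) (cls s) (cls t) = (\<Union>s'\<in>cls s. \<Union>t'\<in>cls t. cls (s' + t'))"
    by (simp add: completion_def vadd_eq cls_def plus_fun_def)
  also have "\<dots> = (\<Union>s'\<in>cls s. \<Union>t'\<in>cls t. cls (s + t))"
    using eq by simp
  also have "\<dots> = cls (s + t)"
    using cls_mem assms by blast
  finally show ?thesis .
qed

lemma vscale_completion:
  assumes "s \<in> cauchys"
  shows "vscale (completion X) c (cls s) = cls (c *\<^sub>R s)"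
proof -
  have eq: "cls (c *\<^sub>R s') = cls (c *\<^sub>R s)" if "s' \<in> cls s" for s'
  proof (rule cls_eqI)
    note mem = in_clsD[OF that]
    show "c *\<^sub>R s' \<in> cauchys" "c *\<^sub>R s \<in> cauchys"
      using mem by auto
    show "limN (c *\<^sub>R s' - c *\<^sub>R s) = 0"
      using mem C.scale[of "s' - s" c] by (simp add: scaleR_diff_right C.N_diff_commute)
  qed
  have "vscale (completion X) c (cls s) = (\<Union>s'\<in>cls s. cls (c *\<^sub>R s'))"
    by (simp add: completion_def vscale_eq cls_def scaleR_fun_def)
  also have "\<dots> = (\<Union>s'\<in>cls s. cls (c *\<^sub>R s))"
    using eq by simp
  also have "\<dots> = cls (c *\<^sub>R s)"
    using cls_mem assms by blast
  finally show ?thesis .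
qed

lemma completion_strongly_subdifferentiable:
  assumes "asymptotically_smooth"
  shows "strongly_subdifferentiable_norm (completion X)"
  unfolding strongly_subdifferentiable_norm_def
proof
  fix Z assume "Z \<in> vsphere (completion X)"
  then obtain z where z: "Z = cls z" "z \<in> cauchys" "limN z = 1"
    by (auto simp: vsphere_def vcarrier_completion vnorm_completion)
  then obtain L where L: "uniform_limit {h \<in> cauchys. limN h = 1}
      (\<lambda>t h. (limN (z + t *\<^sub>R h) - limN z) / t) L (at_right 0)"
    using C.asymptotically_smooth_imp_strongly_subdifferentiable asymptotically_smooth_cauchys assms by blast
  \<comment> \<open>A fixed representative of each class transports the derivative from sequences to
    classes; the quotients themselves depend only on the class.\<close>
  define rep where "rep H = (SOME h. h \<in> cauchys \<and> cls h = H)" for H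
  have rep: "rep H \<in> {h \<in> cauchys. limN h = 1}" "cls (rep H) = H" if "H \<in> vsphere (completion X)" for H
  proof -
    obtain h where "h \<in> cauchys \<and> cls h = H"
      using \<open>H \<in> vsphere (completion X)\<close> by (auto simp: vsphere_def vcarrier_completion)
    then have *: "rep H \<in> cauchys \<and> cls (rep H) = H"
      unfolding rep_def by (rule someI[of "\<lambda>h. h \<in> cauchys \<and> cls h = H"])
    then show "cls (rep H) = H" by simp
    show "rep H \<in> {h \<in> cauchys. limN h = 1}"
      using * \<open>H \<in> vsphere (completion X)\<close> vnorm_completion[of "rep H"] by (simp add: vsphere_def)
  qed
  have "uniform_limit (vsphere (completion X))
      (\<lambda>t H. (limN (z + t *\<^sub>R rep H) - limN z) / t) (\<lambda>H. L (rep H)) (at_right 0)"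
    using rep(1) by (intro uniform_limit_compose'[OF L]) auto
  then have "uniform_limit (vsphere (completion X))
      (\<lambda>t H. (vnorm (completion X) (vadd (completion X) Z (vscale (completion X) t H))
         - vnorm (completion X) Z) / t) (\<lambda>H. L (rep H)) (at_right 0)"
  proof (rule uniform_limit_cong'[THEN iffD1, rotated 2])
    fix t :: real and H assume H: "H \<in> vsphere (completion X)"
    have "vnorm (completion X) (vadd (completion X) Z (vscale (completion X) t (cls (rep H)))) = limN (z + t *\<^sub>R rep H)"
      using rep(1)[OF H] z by (simp add: vscale_completion vadd_completion vnorm_completion)
    then show "(limN (z + t *\<^sub>R rep H) - limN z) / t =
      (vnorm (completion X) (vadd (completion X) Z (vscale (completion X) t H)) - vnorm (completion X) Z) / t"
      using rep[OF H] z by (simp add: vnorm_completion)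
  qed simp
  then show "\<exists>L. uniform_limit (vsphere (completion X))
      (\<lambda>t H. (vnorm (completion X) (vadd (completion X) Z (vscale (completion X) t H))
         - vnorm (completion X) Z) / t) L (at_right 0)"
    by blast
qed

end

section \<open>Weak-star convergence and functionals on the completion\<close>

text \<open>The functionals whose value at \<open>x\<close> lies in an open \<open>U\<close> form
  one of the generating open sets, hence a neighbourhood of \<open>g\<close> if it contains
  \<open>g\<close>.\<close>

lemma limitin_weak_star_evaluation:
  assumes "limitin (weak_star_topology X) f g F" "x \<in> vcarrier X"
  shows "((\<lambda>n. f n x) \<longlongrightarrow> g x) F"
proof (rule topological_tendstoI)
  fix U assume U: "open U" "g x \<in> U"
  let ?V = "{f \<in> vcarrier (dual_space X). f x \<in> U}"
  have op: "openin (weak_star_topology X) ?V"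
    unfolding weak_star_topology_def using U assms(2) by (intro topology_generated_by_Basis) blast
  have "g \<in> topspace (weak_star_topology X)"
    using assms(1) by (simp add: limitin_def)
  then have "g \<in> vcarrier (dual_space X)"
    by (auto simp: weak_star_topology_def topology_generated_by_topspace)
  then have "\<forall>\<^sub>F n in F. f n \<in> ?V"
    using assms(1) op U unfolding limitin_def by blast
  then show "\<forall>\<^sub>F n in F. f n x \<in> U"
    by eventually_elim auto
qed

context seminormed_nspace
begin

interpretation C: seminormed cauchys limN
  by (rule seminormed_cauchys)

lemma dual_completion_abs_le:
  assumes F: "F \<in> vsphere (dual_space (completion X))" and "s \<in> cauchys" "limN s \<le> 1"
  shows "\<bar>F (cls s)\<bar> \<le> 1"
proof -
  let ?B = "{x \<in> vcarrier (completion X). vnorm (completion X) x \<le> 1}"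
  obtain C where C: "\<And>x. x \<in> vcarrier (completion X) \<Longrightarrow> \<bar>F x\<bar> \<le> C * vnorm (completion X) x"
    using F by (auto simp: vsphere_def dual_space_def)
  \<comment> \<open>A real \<open>SUP\<close> is known to dominate its members only over a bounded
    set; the continuity constant \<open>C\<close> provides the bound.\<close>
  have "bdd_above ((\<lambda>x. \<bar>F x\<bar>) ` ?B)"
  proof (rule bdd_aboveI2)
    fix x assume x: "x \<in> ?B"
    then have "0 \<le> vnorm (completion X) x"
      by (auto simp: vcarrier_completion vnorm_completion C.N_nonneg)
    with x C[of x] show "\<bar>F x\<bar> \<le> \<bar>C\<bar>"
      by (smt (verit) mem_Collect_eq mult_left_le mult_right_mono abs_ge_self abs_ge_zero)
  qed
  moreover have "cls s \<in> ?B"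
    using assms by (auto simp: vcarrier_completion vnorm_completion)
  ultimately have "\<bar>F (cls s)\<bar> \<le> (SUP x\<in>?B. \<bar>F x\<bar>)"
    by (rule cSUP_upper[rotated])
  then show ?thesis
    using F by (simp add: vsphere_def dual_space_def)
qed

lemma dual_completion_linear:
  assumes F: "F \<in> vsphere (dual_space (completion X))" and "s \<in> cauchys"
  shows "t \<in> cauchys \<Longrightarrow> F (cls (s + t)) = F (cls s) + F (cls t)" "F (cls (c *\<^sub>R s)) = c * F (cls s)"
proof -
  have lin: "linear_form (completion X) F"
    using F by (simp add: vsphere_def dual_space_def)
  then show "t \<in> cauchys \<Longrightarrow> F (cls (s + t)) = F (cls s) + F (cls t)"
    using assms by (simp add: linear_form_def vcarrier_completion flip: vadd_completion)
  show "F (cls (c *\<^sub>R s)) = c * F (cls s)"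
    using lin assms by (simp add: linear_form_def vcarrier_completion flip: vscale_completion)
qed

lemma dual_completion_bound:
  assumes F: "F \<in> vsphere (dual_space (completion X))" and s: "s \<in> cauchys"
  shows "\<bar>F (cls s)\<bar> \<le> limN s"
proof (rule field_le_epsilon)
  fix e :: real assume "0 < e"
  \<comment> \<open>Adding \<open>e\<close> keeps the divisor positive when \<open>s\<close> is a
    null sequence.\<close>
  define c where "c = 1 / (limN s + e)"
  have pos: "0 < limN s + e" using C.N_nonneg[OF s] \<open>0 < e\<close> by simp
  have "limN (c *\<^sub>R s) \<le> 1"
    using s pos C.N_nonneg[OF s] \<open>0 < e\<close> by (simp add: C.scale c_def)
  then have "\<bar>F (cls (c *\<^sub>R s))\<bar> \<le> 1"
    by (intro dual_completion_abs_le[OF F C.scale_mem[OF s]])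
  then show "\<bar>F (cls s)\<bar> \<le> limN s + e"
    using pos by (simp add: dual_completion_linear[OF F s] abs_mult c_def field_simps)
qed

lemma dual_completion_norming:
  assumes G: "G \<in> vsphere (dual_space (completion X))" and "0 < d"
  shows "\<exists>z\<in>cauchys. limN z \<le> 1 \<and> 1 - d < G (cls z)"
proof -
  let ?B = "{x \<in> vcarrier (completion X). vnorm (completion X) x \<le> 1}"
  have B: "?B = cls ` {s \<in> cauchys. limN s \<le> 1}"
    by (auto simp: vcarrier_completion vnorm_completion)
  have "0 \<in> {s \<in> cauchys. limN s \<le> 1}" by auto
  then have "?B \<noteq> {}" unfolding B by blast
  moreover have "bdd_above ((\<lambda>x. \<bar>G x\<bar>) ` ?B)"
    unfolding B using dual_completion_abs_le[OF G] by (intro bdd_aboveI2[of _ _ 1]) auto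
  moreover have "1 - d < (SUP x\<in>?B. \<bar>G x\<bar>)"
    using G \<open>0 < d\<close> by (simp add: vsphere_def dual_space_def)
  ultimately have "\<exists>x\<in>?B. 1 - d < \<bar>G x\<bar>"
    by (subst (asm) less_cSUP_iff) auto
  then obtain s where s: "s \<in> cauchys" "limN s \<le> 1" "1 - d < \<bar>G (cls s)\<bar>"
    unfolding B by blast
  show ?thesis
  \<comment> \<open>The norm is a supremum of absolute values; passing from \<open>s\<close> to
    \<open>- s\<close> corrects the sign.\<close>
  proof (cases "0 \<le> G (cls s)")
    case True
    with s show ?thesis by auto
  next
    case False
    then have "1 - d < G (cls ((- 1) *\<^sub>R s))"
      using s dual_completion_linear(2)[OF G, of s "- 1"] by simp
    then show ?thesis
      using s C.N_minus[of s] C.scale_mem[of s "- 1"] by (intro bexI[of _ "- s"]) simp_all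
  qed
qed

lemma completion_dual_Kadec_Klee:
  assumes "asymptotically_smooth"
  shows "dual_weak_star_Kadec_Klee (completion X)"
  unfolding dual_weak_star_Kadec_Klee_def
proof (intro allI impI)
  fix f :: "nat \<Rightarrow> (nat \<Rightarrow> 'v) set \<Rightarrow> real" and g
  assume f: "\<forall>n. f n \<in> vsphere (dual_space (completion X))"
    and g: "g \<in> vsphere (dual_space (completion X))"
    and lim: "limitin (weak_star_topology (completion X)) f g sequentially"
  let ?D = "dual_space (completion X)"
  let ?B = "{x \<in> vcarrier (completion X). vnorm (completion X) x \<le> 1}"
  have B: "?B = cls ` {s \<in> cauchys. limN s \<le> 1}"
    by (auto simp: vcarrier_completion vnorm_completion)
  have zero: "0 \<in> {s \<in> cauchys. limN s \<le> 1}" by auto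
  then have ne: "?B \<noteq> {}" unfolding B by blast
  have norm: "vnorm ?D (vdiff ?D (f n) g) = (SUP x\<in>?B. \<bar>f n x - g x\<bar>)" for n
    by (simp add: dual_space_def vdiff_def)
  show "(\<lambda>n. vnorm ?D (vdiff ?D (f n) g)) \<longlonglongrightarrow> 0"
  proof (rule tendstoI)
    fix e :: real assume "0 < e"
    have "0 < e / 2" using \<open>0 < e\<close> by simp
    have "(\<lambda>n. f n (cls s)) \<longlonglongrightarrow> g (cls s)" if "s \<in> cauchys" for s
      using limitin_weak_star_evaluation[OF lim] that by (simp add: vcarrier_completion)
    with \<open>0 < e / 2\<close> have "\<forall>\<^sub>F n in sequentially. \<forall>h\<in>cauchys. limN h \<le> 1 \<longrightarrow> \<bar>f n (cls h) - g (cls h)\<bar> \<le> e / 2"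
      using f g
      by (intro C.asymptotically_smooth_imp_uniform_convergence asymptotically_smooth_cauchys assms
          dual_completion_linear dual_completion_bound dual_completion_norming) auto
    then show "\<forall>\<^sub>F n in sequentially. dist (vnorm ?D (vdiff ?D (f n) g)) 0 < e"
    proof eventually_elim
      case (elim n)
      then have le: "\<And>x. x \<in> ?B \<Longrightarrow> \<bar>f n x - g x\<bar> \<le> e / 2"
        unfolding B by blast
      then have "(SUP x\<in>?B. \<bar>f n x - g x\<bar>) \<le> e / 2"
        using ne by (intro cSUP_least)
      \<comment> \<open>The value at the zero class shows that the supremum is nonnegative, so its
        distance to 0 is the supremum itself.\<close>
      moreover have "bdd_above ((\<lambda>x. \<bar>f n x - g x\<bar>) ` ?B)"
        using le by (intro bdd_aboveI2)
      then have "\<bar>f n (cls 0) - g (cls 0)\<bar> \<le> (SUP x\<in>?B. \<bar>f n x - g x\<bar>)"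
        using zero unfolding B by (intro cSUP_upper) auto
      ultimately show ?case
        using \<open>0 < e\<close> unfolding norm by (simp add: dist_real_def)
    qed
  qed
qed

end

section \<open>Smoothness of the spaces \<open>\<ell>\<^sub>p\<close>\<close>

lemma powr_le_square:
  fixes s p :: real
  assumes "0 \<le> s" "s \<le> 1" "2 \<le> p"
  shows "s powr p \<le> s\<^sup>2"
  using powr_mono'[of 2 p s] assms by simp

lemma one_plus_powr_le_exp:
  fixes u p :: real
  assumes "-1 < u" "0 \<le> p"
  shows "(1 + u) powr p \<le> exp (p * u)"
  using ln_add_one_self_le_self2[of u] assms by (simp add: powr_def mult_left_mono)

text \<open>The linear terms cancel: \<open>exp x \<le> 1 + x + x\<^sup>2\<close>, and
  \<open>exp (- x) \<le> 1 - x + x\<^sup>2\<close> because the product of this right-hand side with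
  the quadratic Taylor polynomial of \<open>exp x\<close> is at least 1.\<close>

lemma exp_add_exp_minus_le:
  fixes x :: real
  assumes "0 \<le> x" "x \<le> 1"
  shows "exp x + exp (- x) \<le> 2 + 2 * x\<^sup>2"
proof -
  have "(1 - x + x\<^sup>2) * (1 + x + x\<^sup>2 / 2) = 1 + (x * x + x * x * x + x * x * x * x) / 2"
    by (simp add: field_simps power2_eq_square)
  then have "1 \<le> (1 - x + x\<^sup>2) * (1 + x + x\<^sup>2 / 2)"
    using assms by simp
  also have "\<dots> \<le> (1 - x + x\<^sup>2) * exp x"
    using assms exp_lower_Taylor_quadratic[of x] by (intro mult_left_mono) auto
  finally have "exp (- x) \<le> 1 - x + x\<^sup>2"
    by (simp add: exp_minus field_simps)
  then show ?thesis
    using exp_bound[OF assms] by simp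
qed

text \<open>If \<open>p\<bar>sb\<bar> < \<bar>a\<bar>\<close>, then \<open>\<bar>a \<plusminus> sb\<bar> powr p \<le> \<bar>a\<bar> powr p * exp (\<plusminus> p\<bar>sb\<bar>/\<bar>a\<bar>)\<close>, and the
  first order terms of the exponentials cancel; otherwise both terms are of order \<open>\<bar>sb\<bar> powr p\<close>.\<close>

lemma powr_add_powr_diff_le:
  fixes a b s p :: real
  assumes "2 \<le> p" "\<bar>s\<bar> \<le> 1"
  shows "\<bar>a + s * b\<bar> powr p + \<bar>a - s * b\<bar> powr p \<le>
    2 * \<bar>a\<bar> powr p + (2 * p\<^sup>2 + 2 * (p + 1) powr p) * s\<^sup>2 * (\<bar>a\<bar> powr p + \<bar>b\<bar> powr p)"
proof (cases "p * \<bar>s * b\<bar> < \<bar>a\<bar>")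
  case True
  define t where "t = \<bar>b\<bar> / \<bar>a\<bar>"
  define u where "u = \<bar>s\<bar> * t"
  have a: "0 < \<bar>a\<bar>"
    using True assms by (intro le_less_trans[OF _ True]) simp
  have u: "0 \<le> u" "p * u < 1"
    using True a by (auto simp: u_def t_def abs_mult field_simps)
  have "u < 1"
    using u assms mult_right_mono[of 1 p u] by simp
  have pu: "\<bar>a\<bar> * u = \<bar>s * b\<bar>"
    using a by (simp add: u_def t_def abs_mult)
  have "(1 + u) powr p + (1 - u) powr p \<le> exp (p * u) + exp (- (p * u))"
    using one_plus_powr_le_exp[of u p] one_plus_powr_le_exp[of "- u" p] u \<open>u < 1\<close> assms by simp
  also have "\<dots> \<le> 2 + 2 * (p * u)\<^sup>2"
    using u assms by (intro exp_add_exp_minus_le) auto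
  also have "\<dots> = 2 + 2 * p\<^sup>2 * s\<^sup>2 * t\<^sup>2"
    by (simp add: u_def power_mult_distrib)
  \<comment> \<open>The square of \<open>t\<close> is traded for a p-th power, since
    \<open>\<bar>a\<bar> powr p * t powr p = \<bar>b\<bar> powr p\<close>.\<close>
  also have "\<dots> \<le> 2 + 2 * p\<^sup>2 * s\<^sup>2 * (1 + t powr p)"
  proof -
    have "t\<^sup>2 \<le> 1 + t powr p"
    proof (cases "t \<le> 1")
      case True
      then have "t\<^sup>2 \<le> 1" by (simp add: t_def abs_square_le_1)
      then show ?thesis by (simp add: add_increasing2)
    next
      case False
      then have "t powr 2 \<le> t powr p" using assms by (intro powr_mono) auto
      then show ?thesis using False by simp
    qed
    then show ?thesis by (intro add_left_mono mult_left_mono) auto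
  qed
  finally have "(1 + u) powr p + (1 - u) powr p \<le> 2 + 2 * p\<^sup>2 * s\<^sup>2 * (1 + t powr p)" .
  then have "\<bar>a\<bar> powr p * ((1 + u) powr p + (1 - u) powr p) \<le>
      \<bar>a\<bar> powr p * (2 + 2 * p\<^sup>2 * s\<^sup>2 * (1 + t powr p))"
    by (intro mult_left_mono) auto
  moreover have "\<bar>a\<bar> powr p * t powr p = \<bar>b\<bar> powr p"
    using a by (simp add: t_def flip: powr_mult)
  then have "\<bar>a\<bar> powr p * (2 + 2 * p\<^sup>2 * s\<^sup>2 * (1 + t powr p)) =
      2 * \<bar>a\<bar> powr p + 2 * p\<^sup>2 * s\<^sup>2 * (\<bar>a\<bar> powr p + \<bar>b\<bar> powr p)"
    by (simp add: distrib_left mult.left_commute[of "\<bar>a\<bar> powr p"])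
  ultimately have "(\<bar>a\<bar> * (1 + u)) powr p + (\<bar>a\<bar> * (1 - u)) powr p \<le>
      2 * \<bar>a\<bar> powr p + 2 * p\<^sup>2 * s\<^sup>2 * (\<bar>a\<bar> powr p + \<bar>b\<bar> powr p)"
    by (simp only: powr_mult distrib_left[symmetric])
  moreover have "\<bar>a + s * b\<bar> powr p + \<bar>a - s * b\<bar> powr p = (\<bar>a\<bar> + \<bar>s * b\<bar>) powr p + (\<bar>a\<bar> - \<bar>s * b\<bar>) powr p"
  proof -
    have "\<bar>s * b\<bar> < \<bar>a\<bar>"
      using mult_strict_left_mono[OF \<open>u < 1\<close> a] pu by simp
    then have "\<bar>a + s * b\<bar> = \<bar>a\<bar> + \<bar>s * b\<bar> \<and> \<bar>a - s * b\<bar> = \<bar>a\<bar> - \<bar>s * b\<bar> \<or>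
       \<bar>a + s * b\<bar> = \<bar>a\<bar> - \<bar>s * b\<bar> \<and> \<bar>a - s * b\<bar> = \<bar>a\<bar> + \<bar>s * b\<bar>"
      by arith
    then show ?thesis by auto
  qed
  ultimately have "\<bar>a + s * b\<bar> powr p + \<bar>a - s * b\<bar> powr p \<le>
      2 * \<bar>a\<bar> powr p + 2 * p\<^sup>2 * s\<^sup>2 * (\<bar>a\<bar> powr p + \<bar>b\<bar> powr p)"
    using pu by (simp add: distrib_left right_diff_distrib)
  \<comment> \<open>The summand \<open>2 * p\<^sup>2\<close> of the constant stems from this case,
    the summand \<open>2 * (p + 1) powr p\<close> from the case
    \<open>\<bar>a\<bar> \<le> p * \<bar>s * b\<bar>\<close>.\<close>
  also have "\<dots> \<le> 2 * \<bar>a\<bar> powr p + (2 * p\<^sup>2 + 2 * (p + 1) powr p) * s\<^sup>2 * (\<bar>a\<bar> powr p + \<bar>b\<bar> powr p)"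
    by (intro add_left_mono mult_right_mono) auto
  finally show ?thesis .
next
  case False
  have "\<bar>a + c * b\<bar> powr p \<le> (p + 1) powr p * s\<^sup>2 * \<bar>b\<bar> powr p" if "\<bar>c\<bar> = \<bar>s\<bar>" for c
  proof -
    have "\<bar>a + c * b\<bar> \<le> (p + 1) * (\<bar>s\<bar> * \<bar>b\<bar>)"
      using False abs_triangle_ineq[of a "c * b"] that by (simp add: abs_mult algebra_simps)
    then have "\<bar>a + c * b\<bar> powr p \<le> ((p + 1) * (\<bar>s\<bar> * \<bar>b\<bar>)) powr p"
      using assms by (intro powr_mono2) auto
    also have "\<dots> = (p + 1) powr p * (\<bar>s\<bar> powr p * \<bar>b\<bar> powr p)"
      by (simp add: powr_mult)
    also have "\<dots> \<le> (p + 1) powr p * (s\<^sup>2 * \<bar>b\<bar> powr p)"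
      using powr_le_square[of "\<bar>s\<bar>" p] assms by (intro mult_left_mono mult_right_mono) auto
    finally show ?thesis by (simp add: mult.assoc)
  qed
  from this[of s] this[of "- s"]
  have "\<bar>a + s * b\<bar> powr p + \<bar>a - s * b\<bar> powr p \<le> (2 * (p + 1) powr p) * (s\<^sup>2 * \<bar>b\<bar> powr p)"
    by (simp add: algebra_simps)
  also have "\<dots> \<le> (2 * p\<^sup>2 + 2 * (p + 1) powr p) * (s\<^sup>2 * (\<bar>a\<bar> powr p + \<bar>b\<bar> powr p))"
    by (intro mult_mono) auto
  finally show ?thesis
    by (simp add: mult.assoc add_increasing)
qed

text \<open>The concave function \<open>x powr (1 / p)\<close> lies below its tangent at 1, obtained
  here from Young's inequality. Being affine in \<open>x\<close>, the bound carries estimates for a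
  sum of two p-th powers over to the sum of the norms.\<close>

lemma powr_root_le:
  fixes x p :: real
  assumes "1 \<le> p" "0 \<le> x"
  shows "x powr (1 / p) \<le> 1 + (x - 1) / p"
proof (cases "x = 0")
  case False
  have "x powr (1 / p) * 1 powr (1 - 1 / p) \<le> 1 / p * x + (1 - 1 / p) * 1"
    using assms False by (intro Youngs_inequality_0) auto
  then show ?thesis
    by (simp add: diff_divide_distrib)
qed (use assms in simp)

section \<open>Norms and disjoint supports in \<open>\<ell>\<^sub>p\<close>\<close>

lemma vadd_lp [simp]: "vadd (lp_space p I) = (+)"
  and vscale_lp [simp]: "vscale (lp_space p I) = (*\<^sub>R)"
  by (simp_all add: lp_space_def fun_eq_iff)

lemma lp_mem_iff:
  "x \<in> vcarrier (lp_space p I) \<longleftrightarrow> (\<forall>i. i \<notin> I \<longrightarrow> x i = 0) \<and> (\<lambda>i. \<bar>x i\<bar> powr p) summable_on I"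
  by (simp add: lp_space_def)

definition lp_sum :: "real \<Rightarrow> 'i set \<Rightarrow> ('i \<Rightarrow> real) \<Rightarrow> real" where
  "lp_sum p I x = (\<Sum>\<^sub>\<infinity>i\<in>I. \<bar>x i\<bar> powr p)"

lemma lp_norm_eq: "vnorm (lp_space p I) x = lp_sum p I x powr (1 / p)"
  by (simp add: lp_space_def lp_sum_def)

lemma lp_sum_nonneg: "0 \<le> lp_sum p I x"
  unfolding lp_sum_def by (intro infsum_nonneg) simp

lemma lp_norm_nonneg: "0 \<le> vnorm (lp_space p I) x"
  by (simp add: lp_norm_eq)

lemma lp_sum_eq: "0 < p \<Longrightarrow> lp_sum p I x = vnorm (lp_space p I) x powr p"
  by (simp add: lp_norm_eq powr_powr lp_sum_nonneg)

lemma lp_sum_le_one_iff: "0 < p \<Longrightarrow> lp_sum p I x \<le> 1 \<longleftrightarrow> vnorm (lp_space p I) x \<le> 1"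
  using powr_le1[of p "vnorm (lp_space p I) x"] powr_le1[of "1 / p" "lp_sum p I x"]
  by (auto simp: lp_norm_nonneg lp_sum_nonneg simp flip: lp_sum_eq lp_norm_eq)

lemma lp_norm_mono:
  "0 < p \<Longrightarrow> lp_sum p I x \<le> lp_sum p I y \<Longrightarrow> vnorm (lp_space p I) x \<le> vnorm (lp_space p I) y"
  unfolding lp_norm_eq by (intro powr_mono2) (auto simp: lp_sum_nonneg)

lemma subspace_lp:
  assumes "0 < p"
  shows "subspace (vcarrier (lp_space p I))"
proof (rule subspaceI)
  fix x y assume x: "x \<in> vcarrier (lp_space p I)" and y: "y \<in> vcarrier (lp_space p I)"
  have "\<bar>x i + y i\<bar> powr p \<le> 2 powr p * (\<bar>x i\<bar> powr p + \<bar>y i\<bar> powr p)" for i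
  proof -
    have "\<bar>x i + y i\<bar> powr p \<le> (2 * max \<bar>x i\<bar> \<bar>y i\<bar>) powr p"
      using assms by (intro powr_mono2) auto
    also have "\<dots> \<le> 2 powr p * (\<bar>x i\<bar> powr p + \<bar>y i\<bar> powr p)"
      by (auto simp: powr_mult max_def)
    finally show ?thesis .
  qed
  moreover have "(\<lambda>i. \<bar>x i\<bar> powr p) summable_on I" "(\<lambda>i. \<bar>y i\<bar> powr p) summable_on I"
    using x y by (simp_all add: lp_mem_iff)
  then have "(\<lambda>i. 2 powr p * (\<bar>x i\<bar> powr p + \<bar>y i\<bar> powr p)) summable_on I"
    by (rule summable_on_cmult_right[OF summable_on_add])
  ultimately have "(\<lambda>i. \<bar>x i + y i\<bar> powr p) summable_on I"
    by - (rule summable_on_comparison_test[of "\<lambda>i. 2 powr p * (\<bar>x i\<bar> powr p + \<bar>y i\<bar> powr p)" I], simp_all)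
  then show "x + y \<in> vcarrier (lp_space p I)"
    using x y by (simp add: lp_mem_iff)
next
  fix c x assume "x \<in> vcarrier (lp_space p I)"
  then show "c *\<^sub>R x \<in> vcarrier (lp_space p I)"
    by (simp add: lp_mem_iff abs_mult powr_mult summable_on_cmult_right)
qed (simp add: lp_mem_iff)

lemma lp_sum_scale: "lp_sum p I (c *\<^sub>R x) = \<bar>c\<bar> powr p * lp_sum p I x"
  unfolding lp_sum_def by (simp add: abs_mult powr_mult infsum_cmult_right')

lemma lp_norm_scale: "0 < p \<Longrightarrow> vnorm (lp_space p I) (c *\<^sub>R x) = \<bar>c\<bar> * vnorm (lp_space p I) x"
  by (simp add: lp_norm_eq lp_sum_scale powr_mult powr_powr)

lemma lp_sum_add_disjoint:
  assumes "x \<in> vcarrier (lp_space p I)" "y \<in> vcarrier (lp_space p I)" "\<And>i. x i = 0 \<or> y i = 0"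
  shows "lp_sum p I (x + y) = lp_sum p I x + lp_sum p I y"
proof -
  have "\<bar>(x + y) i\<bar> powr p = \<bar>x i\<bar> powr p + \<bar>y i\<bar> powr p" for i
    using assms(3)[of i] by auto
  then show ?thesis
    using assms unfolding lp_sum_def by (simp add: lp_mem_iff infsum_add del: plus_fun_apply)
qed

text \<open>On disjoint supports the p-th powers of the norms add up, here to at most
  \<open>1 + \<bar>t\<bar> powr p\<close>; by \<open>powr_root_le\<close> the root divides the bound
  on the excess over 1 by \<open>p\<close>.\<close>

lemma lp_norm_add_disjoint:
  assumes p: "1 \<le> p" and mem: "x \<in> vcarrier (lp_space p I)" "y \<in> vcarrier (lp_space p I)"
    and norms: "vnorm (lp_space p I) x \<le> 1" "vnorm (lp_space p I) y \<le> 1"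
    and disj: "\<And>i. x i = 0 \<or> y i = 0"
  shows "vnorm (lp_space p I) (x + t *\<^sub>R y) \<le> 1 + \<bar>t\<bar> powr p"
proof -
  have "t *\<^sub>R y \<in> vcarrier (lp_space p I)"
    using mem p by (simp add: subspace_lp subspace_scale)
  moreover have "x i = 0 \<or> (t *\<^sub>R y) i = 0" for i
    using disj[of i] by auto
  ultimately have "lp_sum p I (x + t *\<^sub>R y) = lp_sum p I x + \<bar>t\<bar> powr p * lp_sum p I y"
    using lp_sum_add_disjoint[OF mem(1), of "t *\<^sub>R y"] by (simp only: lp_sum_scale)
  moreover have "lp_sum p I x \<le> 1" "lp_sum p I y \<le> 1"
    using norms p by (simp_all add: lp_sum_le_one_iff)
  ultimately have le: "lp_sum p I (x + t *\<^sub>R y) \<le> 1 + \<bar>t\<bar> powr p"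
    by (simp add: add_mono mult_left_le)
  have "vnorm (lp_space p I) (x + t *\<^sub>R y) \<le> 1 + (lp_sum p I (x + t *\<^sub>R y) - 1) / p"
    unfolding lp_norm_eq using p by (intro powr_root_le lp_sum_nonneg) auto
  also have "\<dots> \<le> 1 + \<bar>t\<bar> powr p / p"
    using le p by (intro add_left_mono divide_right_mono) auto
  also have "\<dots> \<le> 1 + \<bar>t\<bar> powr p"
    using p mult_left_mono[of 1 p "\<bar>t\<bar> powr p"] by (simp add: divide_le_eq)
  finally show ?thesis .
qed

text \<open>Summing \<open>powr_add_powr_diff_le\<close> over \<open>I\<close> bounds the sum of the
  two p-th powers without a term linear in \<open>s\<close>, and \<open>powr_root_le\<close> passes
  to the norms. The constant doubles because \<open>x\<close> and \<open>y\<close> each contribute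
  at most 1.\<close>

lemma lp_norm_smooth:
  assumes p: "2 \<le> p"
  shows "\<exists>C>0. \<forall>x\<in>vcarrier (lp_space p I). \<forall>y\<in>vcarrier (lp_space p I). \<forall>s.
     vnorm (lp_space p I) x \<le> 1 \<longrightarrow> vnorm (lp_space p I) y \<le> 1 \<longrightarrow> \<bar>s\<bar> \<le> 1 \<longrightarrow>
     vnorm (lp_space p I) (x + s *\<^sub>R y) + vnorm (lp_space p I) (x - s *\<^sub>R y) \<le> 2 + C * s\<^sup>2"
proof -
  define C where "C = 2 * p\<^sup>2 + 2 * (p + 1) powr p"
  have C: "0 < C" using p by (simp add: C_def add_pos_nonneg)
  have "vnorm (lp_space p I) (x + s *\<^sub>R y) + vnorm (lp_space p I) (x - s *\<^sub>R y) \<le> 2 + 2 * C * s\<^sup>2"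
    if x: "x \<in> vcarrier (lp_space p I)" "vnorm (lp_space p I) x \<le> 1"
      and y: "y \<in> vcarrier (lp_space p I)" "vnorm (lp_space p I) y \<le> 1" and s: "\<bar>s\<bar> \<le> 1" for x y s
  proof -
    have mem: "x + s *\<^sub>R y \<in> vcarrier (lp_space p I)" "x - s *\<^sub>R y \<in> vcarrier (lp_space p I)"
      using x y p subspace_lp[of p I] by (simp_all add: subspace_add subspace_diff subspace_scale)
    have sum_x: "(\<lambda>i. \<bar>x i\<bar> powr p) summable_on I" and sum_y: "(\<lambda>i. \<bar>y i\<bar> powr p) summable_on I"
      and sums: "(\<lambda>i. \<bar>x i + s * y i\<bar> powr p) summable_on I" "(\<lambda>i. \<bar>x i - s * y i\<bar> powr p) summable_on I"
      using mem x y by (simp_all add: lp_mem_iff)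
    note sum_xy = summable_on_cmult_right[OF summable_on_add[OF sum_x sum_y], of "C * s\<^sup>2"]
    have "lp_sum p I (x + s *\<^sub>R y) + lp_sum p I (x - s *\<^sub>R y) =
        (\<Sum>\<^sub>\<infinity>i\<in>I. \<bar>x i + s * y i\<bar> powr p + \<bar>x i - s * y i\<bar> powr p)"
      unfolding lp_sum_def infsum_add[OF sums] by simp
    also have "\<dots> \<le> (\<Sum>\<^sub>\<infinity>i\<in>I. 2 * \<bar>x i\<bar> powr p + C * s\<^sup>2 * (\<bar>x i\<bar> powr p + \<bar>y i\<bar> powr p))"
      using powr_add_powr_diff_le[OF p s] unfolding C_def[symmetric]
      by (rule infsum_mono[OF summable_on_add[OF sums] summable_on_add[OF summable_on_cmult_right[OF sum_x] sum_xy]])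
    also have "\<dots> = 2 * lp_sum p I x + C * s\<^sup>2 * (lp_sum p I x + lp_sum p I y)"
      unfolding lp_sum_def infsum_add[OF summable_on_cmult_right[OF sum_x] sum_xy]
        infsum_cmult_right' infsum_add[OF sum_x sum_y] ..
    also have "\<dots> \<le> 2 * 1 + C * s\<^sup>2 * (1 + 1)"
      using x y p C by (intro add_mono mult_left_mono) (auto simp: lp_sum_le_one_iff)
    finally have le: "lp_sum p I (x + s *\<^sub>R y) + lp_sum p I (x - s *\<^sub>R y) \<le> 2 + 2 * C * s\<^sup>2"
      by simp
    have "vnorm (lp_space p I) (x + s *\<^sub>R y) + vnorm (lp_space p I) (x - s *\<^sub>R y) \<le>
        (1 + (lp_sum p I (x + s *\<^sub>R y) - 1) / p) + (1 + (lp_sum p I (x - s *\<^sub>R y) - 1) / p)"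
      unfolding lp_norm_eq using p by (intro add_mono powr_root_le lp_sum_nonneg) auto
    also have "\<dots> = 2 + (lp_sum p I (x + s *\<^sub>R y) + lp_sum p I (x - s *\<^sub>R y) - 2) / p"
      by (simp add: diff_divide_distrib add_divide_distrib)
    also have "\<dots> \<le> 2 + (2 * C * s\<^sup>2) / p"
      using le p by (intro add_left_mono divide_right_mono) auto
    also have "\<dots> \<le> 2 + 2 * C * s\<^sup>2"
      using p C mult_left_mono[of 1 p "2 * C * s\<^sup>2"] by (simp add: divide_le_eq)
    finally show ?thesis .
  qed
  then show ?thesis
    using C by (intro exI[of _ "2 * C"]) auto
qed

section \<open>Truncation to sets of coordinates\<close>

definition trunc :: "'i set \<Rightarrow> ('i \<Rightarrow> real) \<Rightarrow> 'i \<Rightarrow> real" where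
  "trunc F x = (\<lambda>i. if i \<in> F then x i else 0)"

lemma trunc_disjoint: "trunc F x i = 0 \<or> (y - trunc F y) i = 0"
  by (simp add: trunc_def)

lemma trunc_lp:
  assumes "0 < p" "x \<in> vcarrier (lp_space p I)"
  shows "trunc F x \<in> vcarrier (lp_space p I)" "x - trunc F x \<in> vcarrier (lp_space p I)"
proof -
  have "(\<lambda>i. \<bar>trunc F x i\<bar> powr p) summable_on I"
    using assms by - (rule summable_on_comparison_test[of "\<lambda>i. \<bar>x i\<bar> powr p"], auto simp: lp_mem_iff trunc_def)
  then show *: "trunc F x \<in> vcarrier (lp_space p I)"
    using assms by (simp add: lp_mem_iff trunc_def)
  then show "x - trunc F x \<in> vcarrier (lp_space p I)"
    using assms by (simp add: subspace_diff subspace_lp)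
qed

lemma lp_sum_trunc:
  assumes "0 < p" "x \<in> vcarrier (lp_space p I)"
  shows "lp_sum p I x = lp_sum p I (trunc F x) + lp_sum p I (x - trunc F x)"
proof -
  have "lp_sum p I (trunc F x + (x - trunc F x)) = lp_sum p I (trunc F x) + lp_sum p I (x - trunc F x)"
    by (intro lp_sum_add_disjoint trunc_lp assms trunc_disjoint)
  then show ?thesis by simp
qed

lemma lp_norm_trunc_le:
  assumes "0 < p" "x \<in> vcarrier (lp_space p I)"
  shows "vnorm (lp_space p I) (trunc F x) \<le> vnorm (lp_space p I) x"
    "vnorm (lp_space p I) (x - trunc F x) \<le> vnorm (lp_space p I) x"
  using lp_sum_trunc[OF assms, of F] lp_sum_nonneg[of p I] assms
  by (auto intro!: lp_norm_mono simp: add_increasing add_increasing2)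

text \<open>The p-th power of the norm of the tail is the full sum minus the partial sum over
  \<open>F\<close>, which vanishes in the limit of growing finite
  \<open>F \<subseteq> I\<close>.\<close>

lemma lp_norm_diff_trunc_tendsto:
  assumes "0 < p" "x \<in> vcarrier (lp_space p I)"
  shows "((\<lambda>F. vnorm (lp_space p I) (x - trunc F x)) \<longlongrightarrow> 0) (finite_subsets_at_top I)"
proof -
  have "\<forall>\<^sub>F F in finite_subsets_at_top I. lp_sum p I x - (\<Sum>i\<in>F. \<bar>x i\<bar> powr p) = lp_sum p I (x - trunc F x)"
  proof (rule eventually_finite_subsets_at_top_weakI)
    fix F assume F: "finite F" "F \<subseteq> I"
    have "lp_sum p I (trunc F x) = infsum (\<lambda>i. \<bar>x i\<bar> powr p) F"
      unfolding lp_sum_def using F by (intro infsum_cong_neutral) (auto simp: trunc_def)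
    then show "lp_sum p I x - (\<Sum>i\<in>F. \<bar>x i\<bar> powr p) = lp_sum p I (x - trunc F x)"
      using lp_sum_trunc[OF assms, of F] F by simp
  qed
  moreover have "((\<lambda>F. lp_sum p I x - (\<Sum>i\<in>F. \<bar>x i\<bar> powr p)) \<longlongrightarrow> lp_sum p I x - lp_sum p I x) (finite_subsets_at_top I)"
    using assms unfolding lp_sum_def by (intro tendsto_diff tendsto_const infsum_tendsto) (simp add: lp_mem_iff)
  ultimately have "((\<lambda>F. lp_sum p I (x - trunc F x)) \<longlongrightarrow> 0) (finite_subsets_at_top I)"
    by (simp add: filterlim_cong)
  then have "((\<lambda>F. lp_sum p I (x - trunc F x) powr (1 / p)) \<longlongrightarrow> 0 powr (1 / p)) (finite_subsets_at_top I)"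
    using assms by (intro tendsto_powr') (auto simp: lp_sum_nonneg)
  then show ?thesis
    by (simp add: lp_norm_eq)
qed

lemma lp_abs_le_norm:
  assumes "0 < p" "x \<in> vcarrier (lp_space p I)"
  shows "\<bar>x i\<bar> \<le> vnorm (lp_space p I) x"
proof (cases "i \<in> I")
  case True
  then have "infsum (\<lambda>i. \<bar>x i\<bar> powr p) {i} \<le> lp_sum p I x"
    unfolding lp_sum_def using assms by (intro infsum_mono_neutral) (auto simp: lp_mem_iff)
  then have "(\<bar>x i\<bar> powr p) powr (1 / p) \<le> vnorm (lp_space p I) x"
    unfolding lp_norm_eq using assms by (intro powr_mono2) auto
  then show ?thesis
    using assms by (simp add: powr_powr)
next
  case False
  then show ?thesis
    using assms lp_norm_nonneg[of p I x] by (simp add: lp_mem_iff)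
qed

definition unit_vec :: "'i \<Rightarrow> 'i \<Rightarrow> real" where
  "unit_vec i = (\<lambda>j. if j = i then 1 else 0)"

lemma unit_vec_lp: "0 < p \<Longrightarrow> i \<in> I \<Longrightarrow> unit_vec i \<in> vcarrier (lp_space p I)"
proof -
  assume "0 < p" "i \<in> I"
  then have "(\<lambda>j. \<bar>unit_vec i j\<bar> powr p) summable_on I \<longleftrightarrow> (\<lambda>j. \<bar>unit_vec i j\<bar> powr p) summable_on {i}"
    by (intro summable_on_cong_neutral) (auto simp: unit_vec_def)
  then show ?thesis
    using \<open>i \<in> I\<close> by (auto simp: lp_mem_iff unit_vec_def)
qed

lemma lp_norm_unit_vec:
  assumes "0 < p" "i \<in> I"
  shows "vnorm (lp_space p I) (unit_vec i) = 1"
proof -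
  have "lp_sum p I (unit_vec i) = infsum (\<lambda>j. \<bar>unit_vec i j\<bar> powr p) {i}"
    unfolding lp_sum_def using assms by (intro infsum_cong_neutral) (auto simp: unit_vec_def)
  then show ?thesis
    by (simp add: lp_norm_eq unit_vec_def)
qed

lemma sum_fun_apply: "(\<Sum>i\<in>A. f i) x = (\<Sum>i\<in>A. f i x)"
  by (induction A rule: infinite_finite_induct) auto

lemma trunc_eq_sum: "finite F \<Longrightarrow> trunc F x = (\<Sum>i\<in>F. x i *\<^sub>R unit_vec i)"
  by (simp add: fun_eq_iff trunc_def sum_fun_apply unit_vec_def if_distrib sum.delta' cong: if_cong)

section \<open>The projective norm\<close>

text \<open>Total boundedness of a bounded set of coefficients, made explicit by grids. Each
  induction step adds one vector and spends half of the tolerance on its coefficient.\<close>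

lemma (in seminormed) finite_net:
  assumes "finite A" "0 < \<eta>" "\<And>i. i \<in> A \<Longrightarrow> v i \<in> S" "\<And>i. i \<in> A \<Longrightarrow> N (v i) \<le> 1"
  shows "\<exists>K. finite K \<and> K \<subseteq> S \<and>
    (\<forall>c. (\<forall>i\<in>A. \<bar>c i\<bar> \<le> C) \<longrightarrow> (\<exists>k\<in>K. N ((\<Sum>i\<in>A. c i *\<^sub>R v i) - k) \<le> \<eta>))"
  using assms
proof (induction A arbitrary: \<eta> rule: finite_induct)
  case empty
  then show ?case by (intro exI[of _ "{0}"]) auto
next
  case (insert a A)
  define \<theta> where "\<theta> = \<eta> / 2"
  have \<theta>: "0 < \<theta>" using insert.prems by (simp add: \<theta>_def)
  have "\<exists>K. finite K \<and> K \<subseteq> S \<and>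
    (\<forall>c. (\<forall>i\<in>A. \<bar>c i\<bar> \<le> C) \<longrightarrow> (\<exists>k\<in>K. N ((\<Sum>i\<in>A. c i *\<^sub>R v i) - k) \<le> \<theta>))"
    using insert.prems \<theta> by (intro insert.IH) auto
  then obtain K where K: "finite K" "K \<subseteq> S"
    "\<And>c. (\<forall>i\<in>A. \<bar>c i\<bar> \<le> C) \<Longrightarrow> \<exists>k\<in>K. N ((\<Sum>i\<in>A. c i *\<^sub>R v i) - k) \<le> \<theta>"
    by blast
  \<comment> \<open>Multiples of \<open>\<theta>\<close> from at most one step below
    \<open>- C\<close> up to \<open>C\<close>; rounding down finds one within
    \<open>\<theta>\<close> of any \<open>t\<close> with
    \<open>\<bar>t\<bar> \<le> C\<close>.\<close>
  define D where "D = (\<lambda>j::int. \<theta> * of_int j) ` {\<lfloor>- C / \<theta>\<rfloor>..\<lfloor>C / \<theta>\<rfloor>}"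
  have D: "\<exists>d\<in>D. \<bar>t - d\<bar> \<le> \<theta>" if "\<bar>t\<bar> \<le> C" for t
  proof
    have "- C / \<theta> \<le> t / \<theta>" "t / \<theta> \<le> C / \<theta>"
      using that \<theta> by (intro divide_right_mono; simp)+
    then show "\<theta> * of_int \<lfloor>t / \<theta>\<rfloor> \<in> D"
      unfolding D_def by (intro imageI) (auto intro: floor_mono)
    have "\<bar>t / \<theta> - of_int \<lfloor>t / \<theta>\<rfloor>\<bar> \<le> 1"
      by linarith
    then have "\<bar>\<theta> * (t / \<theta> - of_int \<lfloor>t / \<theta>\<rfloor>)\<bar> \<le> \<theta>"
      using \<theta> by (simp add: abs_mult)
    then show "\<bar>t - \<theta> * of_int \<lfloor>t / \<theta>\<rfloor>\<bar> \<le> \<theta>"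
      using \<theta> by (simp add: right_diff_distrib)
  qed
  have va: "v a \<in> S" "N (v a) \<le> 1"
    using insert.prems by auto
  show ?case
  proof (intro exI conjI allI impI)
    show "finite ((\<lambda>(k, d). k + d *\<^sub>R v a) ` (K \<times> D))"
      using K(1) by (simp add: D_def)
    show "(\<lambda>(k, d). k + d *\<^sub>R v a) ` (K \<times> D) \<subseteq> S"
      using K(2) va by auto
    fix c assume c: "\<forall>i\<in>insert a A. \<bar>c i\<bar> \<le> C"
    obtain k where k: "k \<in> K" "N ((\<Sum>i\<in>A. c i *\<^sub>R v i) - k) \<le> \<theta>"
      using K(3)[of c] c by auto
    obtain d where d: "d \<in> D" "\<bar>c a - d\<bar> \<le> \<theta>"
      using D[of "c a"] c by auto
    have mem: "(\<Sum>i\<in>A. c i *\<^sub>R v i) - k \<in> S"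
      using K(2) k insert.prems subspace by (intro diff_mem subspace_sum) auto
    have "(\<Sum>i\<in>insert a A. c i *\<^sub>R v i) - (k + d *\<^sub>R v a) =
        ((\<Sum>i\<in>A. c i *\<^sub>R v i) - k) + (c a - d) *\<^sub>R v a"
      using insert.hyps by (simp add: algebra_simps)
    then have "N ((\<Sum>i\<in>insert a A. c i *\<^sub>R v i) - (k + d *\<^sub>R v a)) \<le>
        N ((\<Sum>i\<in>A. c i *\<^sub>R v i) - k) + \<bar>c a - d\<bar> * N (v a)"
      using triangle[OF mem scale_mem[OF va(1), of "c a - d"]] scale[OF va(1), of "c a - d"]
      by (simp only:)
    also have "\<dots> \<le> \<theta> + \<theta> * 1"
      using k d va N_nonneg[of "v a"] \<theta> by (intro add_mono mult_mono) auto
    finally show "\<exists>k\<in>(\<lambda>(k, d). k + d *\<^sub>R v a) ` (K \<times> D). N ((\<Sum>i\<in>insert a A. c i *\<^sub>R v i) - k) \<le> \<eta>"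
      using k(1) d(1) by (intro bexI[of _ "k + d *\<^sub>R v a"]) (auto simp: \<theta>_def)
  qed
qed

section \<open>Representations of tensors and the projective seminorm\<close>

locale tensor_pair =
  fixes X :: "'v::real_vector nspace" and Y :: "'w::real_vector nspace"
  assumes X_add: "vadd X = (+)" and X_scale: "vscale X = (*\<^sub>R)"
    and X_subspace: "subspace (vcarrier X)" and X_norm_nonneg: "0 \<le> vnorm X x"
    and X_norm_scale: "vnorm X (c *\<^sub>R x) = \<bar>c\<bar> * vnorm X x"
    and Y_add: "vadd Y = (+)" and Y_scale: "vscale Y = (*\<^sub>R)"
    and Y_subspace: "subspace (vcarrier Y)" and Y_norm_nonneg: "0 \<le> vnorm Y y"
    and Y_norm_scale: "vnorm Y (c *\<^sub>R y) = \<bar>c\<bar> * vnorm Y y"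
begin

abbreviation T :: "('v \<times> 'w) list \<Rightarrow> ('v \<Rightarrow> 'w \<Rightarrow> real) \<Rightarrow> real" where
  "T \<equiv> tensor_sum X Y"

abbreviation \<pi> :: "(('v \<Rightarrow> 'w \<Rightarrow> real) \<Rightarrow> real) \<Rightarrow> real" where
  "\<pi> \<equiv> vnorm (alg_tensor_pi X Y)"

definition pairs :: "('v \<times> 'w) list set" where
  "pairs = {zs. set zs \<subseteq> vcarrier X \<times> vcarrier Y}"

definition weight :: "('v \<times> 'w) list \<Rightarrow> real" where
  "weight zs = (\<Sum>(x, y)\<leftarrow>zs. vnorm X x * vnorm Y y)"

lemma weight_simps [simp]: "weight [] = 0" "weight ((x, y) # zs) = vnorm X x * vnorm Y y + weight zs"
    "weight (zs @ ws) = weight zs + weight ws"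
  by (simp_all add: weight_def)

lemma pairs_simps [simp]: "[] \<in> pairs" "(x, y) # zs \<in> pairs \<longleftrightarrow> x \<in> vcarrier X \<and> y \<in> vcarrier Y \<and> zs \<in> pairs"
    "zs @ ws \<in> pairs \<longleftrightarrow> zs \<in> pairs \<and> ws \<in> pairs"
  by (auto simp: pairs_def)

lemma weight_nonneg: "0 \<le> weight zs"
  unfolding weight_def by (intro sum_list_nonneg) (auto simp: X_norm_nonneg Y_norm_nonneg)

text \<open>The elementary tensor as evaluation of forms. Since \<open>tensor_sum\<close> is 0 at
  arguments that are not bilinear, the identities below hold as equalities of functions.\<close>

definition elem :: "'v \<Rightarrow> 'w \<Rightarrow> ('v \<Rightarrow> 'w \<Rightarrow> real) \<Rightarrow> real" where
  "elem x y = T [(x, y)]"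

lemma T_simps [simp]: "T [] = 0" "T ((x, y) # zs) = elem x y + T zs" "T (zs @ ws) = T zs + T ws"
  by (auto simp: tensor_sum_def elem_def fun_eq_iff)

lemma elem_add:
  "x \<in> vcarrier X \<Longrightarrow> x' \<in> vcarrier X \<Longrightarrow> y \<in> vcarrier Y \<Longrightarrow> elem (x + x') y = elem x y + elem x' y"
  "x \<in> vcarrier X \<Longrightarrow> y \<in> vcarrier Y \<Longrightarrow> y' \<in> vcarrier Y \<Longrightarrow> elem x (y + y') = elem x y + elem x y'"
  by (auto simp: tensor_sum_def elem_def fun_eq_iff bilinear_form_def linear_form_def X_add Y_add)

lemma elem_scale:
  "x \<in> vcarrier X \<Longrightarrow> y \<in> vcarrier Y \<Longrightarrow> elem (c *\<^sub>R x) y = c *\<^sub>R elem x y"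
  "x \<in> vcarrier X \<Longrightarrow> y \<in> vcarrier Y \<Longrightarrow> elem x (c *\<^sub>R y) = c *\<^sub>R elem x y"
  by (auto simp: tensor_sum_def elem_def fun_eq_iff bilinear_form_def linear_form_def X_scale Y_scale)

lemma X_mem [simp, intro]: "x \<in> vcarrier X \<Longrightarrow> c *\<^sub>R x \<in> vcarrier X"
    "x \<in> vcarrier X \<Longrightarrow> x' \<in> vcarrier X \<Longrightarrow> x + x' \<in> vcarrier X"
    "x \<in> vcarrier X \<Longrightarrow> x' \<in> vcarrier X \<Longrightarrow> x - x' \<in> vcarrier X"
  using X_subspace by (simp_all add: subspace_scale subspace_add subspace_diff)

lemma Y_mem [simp, intro]: "y \<in> vcarrier Y \<Longrightarrow> c *\<^sub>R y \<in> vcarrier Y"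
    "y \<in> vcarrier Y \<Longrightarrow> y' \<in> vcarrier Y \<Longrightarrow> y + y' \<in> vcarrier Y"
    "y \<in> vcarrier Y \<Longrightarrow> y' \<in> vcarrier Y \<Longrightarrow> y - y' \<in> vcarrier Y"
  using Y_subspace by (simp_all add: subspace_scale subspace_add subspace_diff)

lemma elem_diff:
  "x \<in> vcarrier X \<Longrightarrow> x' \<in> vcarrier X \<Longrightarrow> y \<in> vcarrier Y \<Longrightarrow> elem (x - x') y = elem x y - elem x' y"
  "x \<in> vcarrier X \<Longrightarrow> y \<in> vcarrier Y \<Longrightarrow> y' \<in> vcarrier Y \<Longrightarrow> elem x (y - y') = elem x y - elem x y'"
  using elem_add(1)[of "x - x'" x' y] elem_add(2)[of x "y - y'" y'] by (simp_all add: X_mem Y_mem)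

lemma elem_sum:
  "finite A \<Longrightarrow> (\<And>i. i \<in> A \<Longrightarrow> f i \<in> vcarrier X) \<Longrightarrow> y \<in> vcarrier Y \<Longrightarrow>
    elem (\<Sum>i\<in>A. f i) y = (\<Sum>i\<in>A. elem (f i) y)"
proof (induction A rule: finite_induct)
  case empty
  then show ?case using elem_scale(1)[of 0 y 0] X_subspace by (simp add: subspace_0)
next
  case (insert a A)
  then show ?case using X_subspace by (simp add: elem_add subspace_sum)
qed

lemma elem_sum_right:
  "finite A \<Longrightarrow> (\<And>i. i \<in> A \<Longrightarrow> g i \<in> vcarrier Y) \<Longrightarrow> x \<in> vcarrier X \<Longrightarrow>
    elem x (\<Sum>i\<in>A. g i) = (\<Sum>i\<in>A. elem x (g i))"
proof (induction A rule: finite_induct)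
  case empty
  then show ?case using elem_scale(2)[of x 0 0] Y_subspace by (simp add: subspace_0)
next
  case (insert a A)
  then show ?case using Y_subspace by (simp add: elem_add subspace_sum)
qed

lemma scale_list:
  assumes "zs \<in> pairs"
  shows "map (\<lambda>(x, y). (c *\<^sub>R x, y)) zs \<in> pairs" "T (map (\<lambda>(x, y). (c *\<^sub>R x, y)) zs) = c *\<^sub>R T zs"
    "weight (map (\<lambda>(x, y). (c *\<^sub>R x, y)) zs) = \<bar>c\<bar> * weight zs"
  using assms by (induction zs) (auto simp: elem_scale X_norm_scale algebra_simps)

lemma alg_tensor_carrier: "vcarrier (alg_tensor_pi X Y) = T ` pairs"
  by (auto simp: alg_tensor_pi_def tensor_reps_def pairs_def)

lemma alg_tensor_norm: "\<pi> u = (INF zs\<in>{zs \<in> pairs. u = T zs}. weight zs)"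
  by (simp add: alg_tensor_pi_def tensor_reps_def pairs_def weight_def)

lemma norm_T_le: "zs \<in> pairs \<Longrightarrow> \<pi> (T zs) \<le> weight zs"
  unfolding alg_tensor_norm by (intro cINF_lower bdd_belowI2[of _ 0]) (auto simp: weight_nonneg)

lemma norm_elem_le: "x \<in> vcarrier X \<Longrightarrow> y \<in> vcarrier Y \<Longrightarrow> \<pi> (elem x y) \<le> vnorm X x * vnorm Y y"
  using norm_T_le[of "[(x, y)]"] by simp

lemma norm_lessE:
  assumes "u \<in> vcarrier (alg_tensor_pi X Y)" "\<pi> u < m"
  obtains zs where "zs \<in> pairs" "u = T zs" "weight zs < m"
proof -
  have "{zs \<in> pairs. u = T zs} \<noteq> {}" "bdd_below (weight ` {zs \<in> pairs. u = T zs})"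
    using assms(1) by (auto simp: alg_tensor_carrier weight_nonneg intro: bdd_belowI2[of _ 0])
  then show ?thesis
    using assms(2) that unfolding alg_tensor_norm by (auto simp: cINF_less_iff)
qed

lemma norm_scale_le:
  assumes "u \<in> vcarrier (alg_tensor_pi X Y)"
  shows "\<pi> (c *\<^sub>R u) \<le> \<bar>c\<bar> * \<pi> u"
proof (rule field_le_epsilon)
  fix e :: real assume "0 < e"
  then obtain zs where zs: "zs \<in> pairs" "u = T zs" "weight zs < \<pi> u + e / (\<bar>c\<bar> + 1)"
    using norm_lessE[OF assms, of "\<pi> u + e / (\<bar>c\<bar> + 1)"] by auto
  have "\<pi> (c *\<^sub>R u) \<le> \<bar>c\<bar> * weight zs"
    using norm_T_le[of "map (\<lambda>(x, y). (c *\<^sub>R x, y)) zs"] scale_list[OF zs(1), of c] zs by simp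
  also have "\<dots> \<le> \<bar>c\<bar> * (\<pi> u + e / (\<bar>c\<bar> + 1))"
    using zs by (intro mult_left_mono) auto
  also have "\<dots> \<le> \<bar>c\<bar> * \<pi> u + e"
    using \<open>0 < e\<close> by (simp add: distrib_left pos_divide_le_eq)
  finally show "\<pi> (c *\<^sub>R u) \<le> \<bar>c\<bar> * \<pi> u + e" .
qed

lemma norm_nonneg: "u \<in> vcarrier (alg_tensor_pi X Y) \<Longrightarrow> 0 \<le> \<pi> u"
  unfolding alg_tensor_norm alg_tensor_carrier by (intro cINF_greatest) (auto simp: weight_nonneg)

text \<open>Subadditivity comes from concatenating nearly optimal representations; for
  \<open>c \<noteq> 0\<close>, homogeneity follows from \<open>norm_scale_le\<close> for both
  \<open>c\<close> and \<open>1 / c\<close>.\<close>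

lemma seminormed_alg_tensor: "seminormed (vcarrier (alg_tensor_pi X Y)) \<pi>"
proof
  show "subspace (vcarrier (alg_tensor_pi X Y))"
  proof (rule subspaceI)
    show "0 \<in> vcarrier (alg_tensor_pi X Y)"
      unfolding alg_tensor_carrier by (intro image_eqI[of _ _ "[]"]) auto
    fix u v assume "u \<in> vcarrier (alg_tensor_pi X Y)" "v \<in> vcarrier (alg_tensor_pi X Y)"
    then obtain zs ws where "zs \<in> pairs" "u = T zs" "ws \<in> pairs" "v = T ws"
      unfolding alg_tensor_carrier by blast
    then show "u + v \<in> vcarrier (alg_tensor_pi X Y)"
      unfolding alg_tensor_carrier by (intro image_eqI[of _ _ "zs @ ws"]) simp_all
  next
    fix c u assume "u \<in> vcarrier (alg_tensor_pi X Y)"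
    then obtain zs where "zs \<in> pairs" "u = T zs"
      unfolding alg_tensor_carrier by blast
    then show "c *\<^sub>R u \<in> vcarrier (alg_tensor_pi X Y)"
      unfolding alg_tensor_carrier using scale_list[of zs c] by (metis imageI)
  qed
  then have mem: "c *\<^sub>R u \<in> vcarrier (alg_tensor_pi X Y)" if "u \<in> vcarrier (alg_tensor_pi X Y)" for c u
    using that by (simp add: subspace_scale)
  show "\<pi> (u + v) \<le> \<pi> u + \<pi> v"
    if u: "u \<in> vcarrier (alg_tensor_pi X Y)" and v: "v \<in> vcarrier (alg_tensor_pi X Y)" for u v
  proof (rule field_le_epsilon)
    fix e :: real assume "0 < e"
    obtain zs where zs: "zs \<in> pairs" "u = T zs" "weight zs < \<pi> u + e / 2"
      using norm_lessE[OF u, of "\<pi> u + e / 2"] \<open>0 < e\<close> by auto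
    obtain ws where ws: "ws \<in> pairs" "v = T ws" "weight ws < \<pi> v + e / 2"
      using norm_lessE[OF v, of "\<pi> v + e / 2"] \<open>0 < e\<close> by auto
    show "\<pi> (u + v) \<le> \<pi> u + \<pi> v + e"
      using norm_T_le[of "zs @ ws"] zs ws by simp
  qed
  show "\<pi> (c *\<^sub>R u) = \<bar>c\<bar> * \<pi> u" if u: "u \<in> vcarrier (alg_tensor_pi X Y)" for c u
  proof (cases "c = 0")
    case True
    then show ?thesis
      using norm_scale_le[OF u, of 0] norm_nonneg[OF mem[OF u, of 0]] by simp
  next
    case False
    have "\<pi> u \<le> \<bar>1 / c\<bar> * \<pi> (c *\<^sub>R u)"
      using norm_scale_le[OF mem[OF u, of c], of "1 / c"] False by simp
    then have "\<bar>c\<bar> * \<pi> u \<le> \<pi> (c *\<^sub>R u)"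
      using False by (simp add: field_simps)
    then show ?thesis
      using norm_scale_le[OF u, of c] by simp
  qed
qed

sublocale A: seminormed_nspace "alg_tensor_pi X Y"
proof (rule seminormed_nspace.intro)
  show "vadd (alg_tensor_pi X Y) = (+)" "vscale (alg_tensor_pi X Y) = (*\<^sub>R)"
    by (simp_all add: alg_tensor_pi_def fun_eq_iff)
qed (rule seminormed_alg_tensor)

lemma T_mem [simp, intro]: "zs \<in> pairs \<Longrightarrow> T zs \<in> vcarrier (alg_tensor_pi X Y)"
  by (simp add: alg_tensor_carrier)

lemma elem_mem [simp, intro]: "x \<in> vcarrier X \<Longrightarrow> y \<in> vcarrier Y \<Longrightarrow> elem x y \<in> vcarrier (alg_tensor_pi X Y)"
  unfolding elem_def by (intro T_mem) simp

section \<open>Perturbing a tensor by a small multiple of another\<close>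

lemma norm_elem_perturb_le:
  assumes "x \<in> vcarrier X" "a \<in> vcarrier X" "y \<in> vcarrier Y" "b \<in> vcarrier Y"
  shows "2 * \<pi> (elem x y + (s * t) *\<^sub>R elem a b) \<le>
    vnorm X (x + s *\<^sub>R a) * vnorm Y (y + t *\<^sub>R b) + vnorm X (x - s *\<^sub>R a) * vnorm Y (y - t *\<^sub>R b)"
proof -
  let ?zs = "[(x + s *\<^sub>R a, y + t *\<^sub>R b), (x - s *\<^sub>R a, y - t *\<^sub>R b)]"
  let ?w = "elem x y + (s * t) *\<^sub>R elem a b"
  \<comment> \<open>The mixed tensors \<open>elem x b\<close> and \<open>elem a y\<close> occur with
    opposite signs and cancel; only the product \<open>s * t\<close> survives.\<close>
  have "T ?zs = ?w + ?w"
    using assms by (simp add: elem_add elem_diff elem_scale scaleR_add_right scaleR_diff_right mult.commute)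
  then have "T ?zs = 2 *\<^sub>R ?w"
    by (simp only: scaleR_2)
  then have "2 * \<pi> (elem x y + (s * t) *\<^sub>R elem a b) = \<pi> (T ?zs)"
    using A.scale[of "elem x y + (s * t) *\<^sub>R elem a b" 2] assms by simp
  also have "\<dots> \<le> weight ?zs"
    using assms by (intro norm_T_le) simp
  finally show ?thesis by simp
qed

text \<open>Scalars move freely between the two factors, so any positive bound
  \<open>\<kappa>\<close> of the product of the norms can be extracted with both factors left in the
  unit balls.\<close>

lemma elem_normalize:
  assumes "x \<in> vcarrier X" "y \<in> vcarrier Y" "vnorm X x * vnorm Y y \<le> \<kappa>" "0 < \<kappa>"
  obtains \<alpha> \<beta> where "vnorm X (\<alpha> *\<^sub>R x) \<le> 1" "vnorm Y (\<beta> *\<^sub>R y) \<le> 1"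
    "elem x y = \<kappa> *\<^sub>R elem (\<alpha> *\<^sub>R x) (\<beta> *\<^sub>R y)"
proof (cases "vnorm Y y = 0")
  case True
  show thesis
  proof (rule that)
    \<comment> \<open>Here \<open>y\<close> has norm 0 and can absorb any scalar, so
      \<open>x\<close> is scaled into the unit ball; the added 1 excludes division by 0.\<close>
    show "vnorm X ((1 / (vnorm X x + 1)) *\<^sub>R x) \<le> 1"
      using X_norm_nonneg[of x] by (simp add: X_norm_scale pos_divide_le_eq)
    show "vnorm Y (((vnorm X x + 1) / \<kappa>) *\<^sub>R y) \<le> 1"
      using True by (simp add: Y_norm_scale)
    have "vnorm X x + 1 \<noteq> 0" using X_norm_nonneg[of x] by simp
    then show "elem x y = \<kappa> *\<^sub>R elem ((1 / (vnorm X x + 1)) *\<^sub>R x) (((vnorm X x + 1) / \<kappa>) *\<^sub>R y)"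
      using assms by (simp add: elem_scale)
  qed
next
  case False
  then have pos: "0 < vnorm Y y" using Y_norm_nonneg[of y] by simp
  show thesis
  proof (rule that)
    show "vnorm X ((vnorm Y y / \<kappa>) *\<^sub>R x) \<le> 1"
      using assms pos by (simp add: X_norm_scale field_simps)
    show "vnorm Y ((1 / vnorm Y y) *\<^sub>R y) \<le> 1"
      using pos by (simp add: Y_norm_scale)
    show "elem x y = \<kappa> *\<^sub>R elem ((vnorm Y y / \<kappa>) *\<^sub>R x) ((1 / vnorm Y y) *\<^sub>R y)"
      using assms pos by (simp add: elem_scale)
  qed
qed

text \<open>The estimate for elementary tensors extends to sums because it is jointly homogeneous in the
  weights \<open>\<kappa>\<close> and \<open>\<mu>\<close> of the two arguments; the weights are upper bounds so that they can be
  prescribed later.\<close>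

lemma norm_T_perturb_le:
  assumes R: "0 \<le> R" "R \<le> 1" and e: "0 \<le> e"
    and Z: "Z \<subseteq> vcarrier X \<times> vcarrier Y" "\<And>x y \<alpha> \<beta>. (x, y) \<in> Z \<Longrightarrow> (\<alpha> *\<^sub>R x, \<beta> *\<^sub>R y) \<in> Z"
    and U: "U \<subseteq> vcarrier X \<times> vcarrier Y" "\<And>x y \<alpha> \<beta>. (x, y) \<in> U \<Longrightarrow> (\<alpha> *\<^sub>R x, \<beta> *\<^sub>R y) \<in> U"
    and elementary: "\<And>x y a b. (x, y) \<in> Z \<Longrightarrow> (a, b) \<in> U \<Longrightarrow> vnorm X x \<le> 1 \<Longrightarrow> vnorm Y y \<le> 1 \<Longrightarrow>
      vnorm X a \<le> 1 \<Longrightarrow> vnorm Y b \<le> 1 \<Longrightarrow> \<pi> (elem x y + R *\<^sub>R elem a b) \<le> 1 + e * R"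
    and zs: "set zs \<subseteq> Z" "weight zs \<le> \<kappa>" and us: "set us \<subseteq> U" "weight us \<le> \<mu>"
  shows "\<pi> (\<mu> *\<^sub>R T zs + (R * \<kappa>) *\<^sub>R T us) \<le> \<kappa> * \<mu> * (1 + e * R)"
proof -
  \<comment> \<open>One elementary tensor on each side; \<open>left\<close> then sums over
    \<open>us\<close> for fixed \<open>(x, y)\<close>, and the last induction sums over
    \<open>zs\<close>. Positive weights are normalized away by \<open>elem_normalize\<close>; if a
    weight is 0, the triangle inequality already gives the bound 0.\<close>
  have single: "\<pi> (\<mu> *\<^sub>R elem x y + (R * \<kappa>) *\<^sub>R elem a b) \<le> \<kappa> * \<mu> * (1 + e * R)"
    if xy: "(x, y) \<in> Z" "vnorm X x * vnorm Y y \<le> \<kappa>" and ab: "(a, b) \<in> U" "vnorm X a * vnorm Y b \<le> \<mu>"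
    for x y a b \<kappa> \<mu>
  proof (cases "\<kappa> = 0 \<or> \<mu> = 0")
    case True
    have mem: "x \<in> vcarrier X" "y \<in> vcarrier Y" "a \<in> vcarrier X" "b \<in> vcarrier Y"
      using Z U xy ab by auto
    have nn: "0 \<le> \<kappa>" "0 \<le> \<mu>"
      using xy(2) ab(2) X_norm_nonneg Y_norm_nonneg by (meson mult_nonneg_nonneg order_trans)+
    have "\<pi> (\<mu> *\<^sub>R elem x y + (R * \<kappa>) *\<^sub>R elem a b) \<le> \<mu> * \<pi> (elem x y) + (R * \<kappa>) * \<pi> (elem a b)"
      using A.triangle[of "\<mu> *\<^sub>R elem x y" "(R * \<kappa>) *\<^sub>R elem a b"] mem nn R
      by (simp add: A.scale)
    also have "\<dots> \<le> \<mu> * \<kappa> + (R * \<kappa>) * \<mu>"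
      using norm_elem_le[OF mem(1,2)] norm_elem_le[OF mem(3,4)] xy ab nn R
      by (intro add_mono mult_left_mono) auto
    finally show ?thesis using True by auto
  next
    case False
    have nn: "0 < \<kappa>" "0 < \<mu>"
      using False xy(2) ab(2) X_norm_nonneg Y_norm_nonneg
      by (metis mult_nonneg_nonneg order_trans order_le_less)+
    obtain \<alpha> \<beta> where 1: "vnorm X (\<alpha> *\<^sub>R x) \<le> 1" "vnorm Y (\<beta> *\<^sub>R y) \<le> 1" "elem x y = \<kappa> *\<^sub>R elem (\<alpha> *\<^sub>R x) (\<beta> *\<^sub>R y)"
      using elem_normalize[OF _ _ xy(2) nn(1)] Z xy(1) by blast
    obtain \<gamma> \<delta> where 2: "vnorm X (\<gamma> *\<^sub>R a) \<le> 1" "vnorm Y (\<delta> *\<^sub>R b) \<le> 1" "elem a b = \<mu> *\<^sub>R elem (\<gamma> *\<^sub>R a) (\<delta> *\<^sub>R b)"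
      using elem_normalize[OF _ _ ab(2) nn(2)] U ab(1) by blast
    have mem: "(\<alpha> *\<^sub>R x, \<beta> *\<^sub>R y) \<in> Z" "(\<gamma> *\<^sub>R a, \<delta> *\<^sub>R b) \<in> U"
      using Z U xy ab by auto
    let ?w = "elem (\<alpha> *\<^sub>R x) (\<beta> *\<^sub>R y) + R *\<^sub>R elem (\<gamma> *\<^sub>R a) (\<delta> *\<^sub>R b)"
    have "?w \<in> vcarrier (alg_tensor_pi X Y)"
      using mem Z(1) U(1) by (intro A.add_mem A.scale_mem elem_mem) auto
    then have "\<pi> ((\<kappa> * \<mu>) *\<^sub>R ?w) = \<kappa> * \<mu> * \<pi> ?w"
      using A.scale[of ?w "\<kappa> * \<mu>"] nn by simp
    also have "\<dots> \<le> \<kappa> * \<mu> * (1 + e * R)"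
      using elementary[OF mem 1(1,2) 2(1,2)] nn by (intro mult_left_mono) auto
    also have "(\<kappa> * \<mu>) *\<^sub>R ?w = \<mu> *\<^sub>R elem x y + (R * \<kappa>) *\<^sub>R elem a b"
      unfolding 1(3) 2(3) by (simp add: scaleR_add_right mult_ac)
    finally show ?thesis .
  qed
  have left: "\<pi> (\<mu> *\<^sub>R elem x y + (R * \<kappa>) *\<^sub>R T us) \<le> \<kappa> * \<mu> * (1 + e * R)"
    if xy: "(x, y) \<in> Z" "vnorm X x * vnorm Y y \<le> \<kappa>" and "set us \<subseteq> U" "weight us \<le> \<mu>" for x y \<kappa> \<mu> us
    using that(3,4)
  proof (induction us arbitrary: \<mu>)
    case Nil
    have mem: "x \<in> vcarrier X" "y \<in> vcarrier Y" using Z xy by auto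
    have "0 \<le> \<kappa>"
      using xy(2) X_norm_nonneg Y_norm_nonneg by (meson mult_nonneg_nonneg order_trans)
    have "\<pi> (\<mu> *\<^sub>R elem x y) = \<mu> * \<pi> (elem x y)"
      using Nil mem by (simp add: A.scale)
    also have "\<dots> \<le> \<mu> * \<kappa>"
      using norm_elem_le[OF mem] xy(2) Nil by (intro mult_left_mono) auto
    also have "\<dots> \<le> \<kappa> * \<mu> * (1 + e * R)"
      using \<open>0 \<le> \<kappa>\<close> Nil e R by (simp add: algebra_simps)
    finally show ?case
      by (simp only: T_simps scaleR_zero_right add_0_right)
  next
    case (Cons u us)
    obtain a b where u: "u = (a, b)" by (cases u)
    let ?m = "vnorm X a * vnorm Y b"
    have mem: "x \<in> vcarrier X" "y \<in> vcarrier Y" "a \<in> vcarrier X" "b \<in> vcarrier Y" "us \<in> pairs"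
      using Z U xy Cons.prems by (auto simp: u pairs_def)
    let ?v = "?m *\<^sub>R elem x y + (R * \<kappa>) *\<^sub>R elem a b"
    let ?w = "(\<mu> - ?m) *\<^sub>R elem x y + (R * \<kappa>) *\<^sub>R T us"
    \<comment> \<open>The head \<open>(a, b)\<close> takes exactly its own weight out of
      \<open>\<mu>\<close>; what remains, \<open>\<mu> - ?m\<close>, still bounds the weight of the
      tail.\<close>
    have split: "\<mu> *\<^sub>R elem x y + (R * \<kappa>) *\<^sub>R T (u # us) = ?v + ?w"
      by (simp add: u algebra_simps)
    have "\<pi> (?v + ?w) \<le> \<pi> ?v + \<pi> ?w"
      using mem by (intro A.triangle A.add_mem A.scale_mem elem_mem T_mem)
    moreover have "\<pi> ?v \<le> \<kappa> * ?m * (1 + e * R)"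
      using Cons.prems by (intro single xy order_refl) (simp add: u)
    moreover have "\<pi> ?w \<le> \<kappa> * (\<mu> - ?m) * (1 + e * R)"
      using Cons.prems by (intro Cons.IH) (simp_all add: u)
    ultimately have "\<pi> (?v + ?w) \<le> \<kappa> * ?m * (1 + e * R) + \<kappa> * (\<mu> - ?m) * (1 + e * R)"
      by linarith
    also have "\<dots> = \<kappa> * \<mu> * (1 + e * R)"
      by (simp add: algebra_simps)
    finally show ?case unfolding split .
  qed
  show ?thesis
    using zs
  proof (induction zs arbitrary: \<kappa>)
    case Nil
    have "us \<in> pairs" using us U by (auto simp: pairs_def)
    have "0 \<le> \<mu>" using us weight_nonneg[of us] by simp
    have "\<pi> ((R * \<kappa>) *\<^sub>R T us) = R * \<kappa> * \<pi> (T us)"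
      using Nil R \<open>us \<in> pairs\<close> by (simp add: A.scale)
    also have "\<dots> \<le> 1 * \<kappa> * \<mu>"
      using norm_T_le[OF \<open>us \<in> pairs\<close>] us Nil R \<open>us \<in> pairs\<close>
      by (intro mult_mono) (auto intro: norm_nonneg)
    also have "\<dots> \<le> \<kappa> * \<mu> * (1 + e * R)"
      using \<open>0 \<le> \<mu>\<close> Nil e R by (simp add: algebra_simps)
    finally show ?case
      by (simp only: T_simps scaleR_zero_right add_0_left)
  next
    case (Cons z zs)
    obtain x y where z: "z = (x, y)" by (cases z)
    let ?l = "vnorm X x * vnorm Y y"
    have mem: "x \<in> vcarrier X" "y \<in> vcarrier Y" "zs \<in> pairs" "us \<in> pairs"
      using Z U us Cons.prems by (auto simp: z pairs_def)
    let ?v = "\<mu> *\<^sub>R elem x y + (R * ?l) *\<^sub>R T us"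
    let ?w = "\<mu> *\<^sub>R T zs + (R * (\<kappa> - ?l)) *\<^sub>R T us"
    have split: "\<mu> *\<^sub>R T (z # zs) + (R * \<kappa>) *\<^sub>R T us = ?v + ?w"
      by (simp add: z algebra_simps)
    have "\<pi> (?v + ?w) \<le> \<pi> ?v + \<pi> ?w"
      using mem by (intro A.triangle A.add_mem A.scale_mem elem_mem T_mem)
    moreover have "\<pi> ?v \<le> ?l * \<mu> * (1 + e * R)"
      using Cons.prems by (intro left us order_refl) (simp add: z)
    moreover have "\<pi> ?w \<le> (\<kappa> - ?l) * \<mu> * (1 + e * R)"
      using Cons.prems by (intro Cons.IH) (simp_all add: z)
    ultimately have "\<pi> (?v + ?w) \<le> ?l * \<mu> * (1 + e * R) + (\<kappa> - ?l) * \<mu> * (1 + e * R)"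
      by linarith
    also have "\<dots> = \<kappa> * \<mu> * (1 + e * R)"
      by (simp add: algebra_simps)
    finally show ?case unfolding split .
  qed
qed

end

section \<open>The projective tensor product of \<open>\<ell>\<^sub>p\<close> and \<open>\<ell>\<^sub>q\<close>\<close>

text \<open>With \<open>s\<close> and \<open>t\<close> proportional, \<open>R = s t\<close> and \<open>s\<^sup>2\<close> have the same order and a small ratio \<open>s/t\<close>
  makes \<open>C s\<^sup>2\<close> small against \<open>R\<close>, while \<open>t powr q\<close> has higher order because \<open>q > 2\<close>.\<close>

lemma perturbation_parameters:
  fixes q C e :: real
  assumes "2 < q" "0 < C" "0 < e"
  shows "\<exists>R0>0. \<forall>R. 0 < R \<longrightarrow> R \<le> R0 \<longrightarrow>
    (\<exists>s t. 0 \<le> s \<and> s \<le> 1 \<and> 0 \<le> t \<and> s * t = R \<and> (1 + C * s\<^sup>2) * (1 + t powr q) \<le> 1 + e * R)"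
proof -
  \<comment> \<open>\<open>c\<close> is the ratio \<open>s / t\<close>, so that
    \<open>R = c * t\<^sup>2\<close> and \<open>C * s\<^sup>2 = C * c * R \<le> e / 4 * R\<close>.
    The bound \<open>d\<close> on \<open>t powr (q - 2)\<close> makes
    \<open>(1 + C) * t powr q \<le> e / 2 * R\<close>.\<close>
  define c where "c = min 1 (e / (4 * C))"
  define d where "d = e * c / (2 * (1 + C))"
  define t1 where "t1 = min 1 (d powr (1 / (q - 2)))"
  have c: "0 < c" "c \<le> 1" "C * c \<le> e / 4"
  proof -
    show "0 < c" "c \<le> 1" using assms by (simp_all add: c_def)
    have "C * c \<le> C * (e / (4 * C))" using assms by (intro mult_left_mono) (auto simp: c_def)
    then show "C * c \<le> e / 4" using assms by simp
  qed
  have d: "0 < d" using c assms by (simp add: d_def)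
  have d_eq: "(1 + C) * d = e * c / 2"
    using assms by (simp add: d_def field_simps)
  have t1: "0 < t1" "t1 \<le> 1" using d by (simp_all add: t1_def)
  have t1_powr: "t1 powr (q - 2) \<le> d"
  proof -
    have "t1 powr (q - 2) \<le> (d powr (1 / (q - 2))) powr (q - 2)"
      using assms t1 by (intro powr_mono2) (auto simp: t1_def)
    then show ?thesis using assms d by (simp add: powr_powr)
  qed
  show ?thesis
  proof (rule exI[of _ "c * t1\<^sup>2"], intro conjI allI impI)
    show "0 < c * t1\<^sup>2" using c t1 by simp
    fix R assume R: "0 < R" "R \<le> c * t1\<^sup>2"
    define t where "t = sqrt (R / c)"
    have t2: "t\<^sup>2 = R / c" using R c by (simp add: t_def)
    have "t \<le> sqrt (t1\<^sup>2)"
      unfolding t_def using R c by (intro real_sqrt_le_mono) (simp add: pos_divide_le_eq mult.commute)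
    then have t: "0 < t" "t \<le> t1" using R c t1 by (auto simp: t_def)
    have "(c * t) * t = R"
      using t2 c by (simp add: power2_eq_square field_simps)
    moreover have "c * t \<le> 1"
      using c t t1 by (intro mult_le_one) auto
    moreover have "(1 + C * (c * t)\<^sup>2) * (1 + t powr q) \<le> 1 + e * R"
    proof -
      have "C * (c * t)\<^sup>2 = (C * c) * ((c * t) * t)"
        by (simp add: power2_eq_square)
      then have s2: "C * (c * t)\<^sup>2 = (C * c) * R"
        by (simp only: \<open>(c * t) * t = R\<close>)
      then have small: "C * (c * t)\<^sup>2 \<le> e / 4 * R"
        unfolding s2 using mult_right_mono[OF c(3), of R] R by simp
      have "(c * t)\<^sup>2 \<le> 1"
        using \<open>c * t \<le> 1\<close> c t by (simp add: abs_square_le_1)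
      then have le: "1 + C * (c * t)\<^sup>2 \<le> 1 + C"
        using assms mult_left_le[of "(c * t)\<^sup>2" C] by simp
      have "t powr q = t powr 2 * t powr (q - 2)"
        by (simp flip: powr_add)
      also have "\<dots> \<le> t\<^sup>2 * d"
        using t t1_powr powr_mono2[of "q - 2" t t1] assms by (intro mult_mono) auto
      finally have "(1 + C * (c * t)\<^sup>2) * t powr q \<le> (1 + C) * (t\<^sup>2 * d)"
        using le assms by (intro mult_mono) auto
      also have "\<dots> = (e * c / 2) * t\<^sup>2"
        using d_eq by (metis mult.assoc mult.commute)
      also have "\<dots> = e / 2 * R"
        using t2 c by simp
      finally have "(1 + C * (c * t)\<^sup>2) * t powr q \<le> e / 2 * R" .
      moreover have "0 \<le> e * R" using assms R by simp
      ultimately show ?thesis using small by (simp add: distrib_left)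
    qed
    ultimately show "\<exists>s t. 0 \<le> s \<and> s \<le> 1 \<and> 0 \<le> t \<and> s * t = R \<and> (1 + C * s\<^sup>2) * (1 + t powr q) \<le> 1 + e * R"
      using c t by (intro exI[of _ "c * t"] exI[of _ t]) auto
  qed
qed

locale lp_pair =
  fixes p q :: real and I :: "'i set" and J :: "'j set"
  assumes p: "2 < p" and q: "2 < q"
begin

abbreviation "X \<equiv> lp_space p I"
abbreviation "Y \<equiv> lp_space q J"

sublocale tensor_pair X Y
  using p q by unfold_locales (auto simp: subspace_lp lp_norm_nonneg lp_norm_scale)

section \<open>Disjointly supported perturbations\<close>

text \<open>The factor with disjoint supports receives the parameter \<open>t\<close>, the other one
  the parameter \<open>s\<close>. Estimates for all small \<open>R\<close> let the two choices of
  the disjoint factor share the same \<open>R\<close>.\<close>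

lemma elementary_perturbation:
  assumes e: "0 < e"
  shows "\<exists>R0>0. \<forall>R. 0 < R \<longrightarrow> R \<le> R0 \<longrightarrow> (\<forall>x\<in>vcarrier X. \<forall>a\<in>vcarrier X. \<forall>y\<in>vcarrier Y. \<forall>b\<in>vcarrier Y.
    vnorm X x \<le> 1 \<longrightarrow> vnorm X a \<le> 1 \<longrightarrow> vnorm Y y \<le> 1 \<longrightarrow> vnorm Y b \<le> 1 \<longrightarrow>
    (\<forall>i. x i = 0 \<or> a i = 0) \<or> (\<forall>j. y j = 0 \<or> b j = 0) \<longrightarrow> \<pi> (elem x y + R *\<^sub>R elem a b) \<le> 1 + e * R)"
proof -
  obtain C1 where C1: "0 < C1" "\<forall>x\<in>vcarrier X. \<forall>y\<in>vcarrier X. \<forall>s.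
     vnorm X x \<le> 1 \<longrightarrow> vnorm X y \<le> 1 \<longrightarrow> \<bar>s\<bar> \<le> 1 \<longrightarrow> vnorm X (x + s *\<^sub>R y) + vnorm X (x - s *\<^sub>R y) \<le> 2 + C1 * s\<^sup>2"
    using lp_norm_smooth[of p I] p by auto
  obtain C2 where C2: "0 < C2" "\<forall>x\<in>vcarrier Y. \<forall>y\<in>vcarrier Y. \<forall>s.
     vnorm Y x \<le> 1 \<longrightarrow> vnorm Y y \<le> 1 \<longrightarrow> \<bar>s\<bar> \<le> 1 \<longrightarrow> vnorm Y (x + s *\<^sub>R y) + vnorm Y (x - s *\<^sub>R y) \<le> 2 + C2 * s\<^sup>2"
    using lp_norm_smooth[of q J] q by auto
  obtain R1 where R1: "0 < R1" "\<forall>R. 0 < R \<longrightarrow> R \<le> R1 \<longrightarrow>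
    (\<exists>s t. 0 \<le> s \<and> s \<le> 1 \<and> 0 \<le> t \<and> s * t = R \<and> (1 + C1 * s\<^sup>2) * (1 + t powr q) \<le> 1 + e * R)"
    using perturbation_parameters[OF q C1(1) e] by blast
  obtain R2 where R2: "0 < R2" "\<forall>R. 0 < R \<longrightarrow> R \<le> R2 \<longrightarrow>
    (\<exists>s t. 0 \<le> s \<and> s \<le> 1 \<and> 0 \<le> t \<and> s * t = R \<and> (1 + C2 * s\<^sup>2) * (1 + t powr p) \<le> 1 + e * R)"
    using perturbation_parameters[OF p C2(1) e] by blast
  \<comment> \<open>Each of \<open>f1\<close> and \<open>f2\<close> may deviate from 1 to first
    order in \<open>s\<close>; the common bound \<open>1 + w\<close> of \<open>g1\<close> and
    \<open>g2\<close> is factored out so that only \<open>f1 + f2\<close> matters.\<close>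
  have combine: "m \<le> 1 + e * R"
    if "2 * m \<le> f1 * g1 + f2 * g2" "f1 + f2 \<le> 2 + C * s\<^sup>2" "g1 \<le> 1 + w" "g2 \<le> 1 + w"
      "0 \<le> f1" "0 \<le> f2" "0 \<le> w" "0 < C" "(1 + C * s\<^sup>2) * (1 + w) \<le> 1 + e * R"
    for m f1 g1 f2 g2 w C s R :: real
  proof -
    have "2 * m \<le> f1 * (1 + w) + f2 * (1 + w)"
      using that(1) mult_left_mono[OF that(3,5)] mult_left_mono[OF that(4,6)] by linarith
    also have "\<dots> = (f1 + f2) * (1 + w)" by (simp add: distrib_right)
    also have "\<dots> \<le> (2 * (1 + C * s\<^sup>2)) * (1 + w)"
      using that by (intro mult_right_mono order_trans[OF that(2)]) auto
    also have "\<dots> = 2 * ((1 + C * s\<^sup>2) * (1 + w))" by simp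
    finally show ?thesis using that(9) by linarith
  qed
  have "\<pi> (elem x y + R *\<^sub>R elem a b) \<le> 1 + e * R"
    if R: "0 < R" "R \<le> min R1 R2"
      and mem: "x \<in> vcarrier X" "a \<in> vcarrier X" "y \<in> vcarrier Y" "b \<in> vcarrier Y"
      and norms: "vnorm X x \<le> 1" "vnorm X a \<le> 1" "vnorm Y y \<le> 1" "vnorm Y b \<le> 1"
      and disj: "(\<forall>i. x i = 0 \<or> a i = 0) \<or> (\<forall>j. y j = 0 \<or> b j = 0)" for R x a y b
    using disj
  proof
    assume disj: "\<forall>j. y j = 0 \<or> b j = 0"
    obtain s t where st: "0 \<le> s" "s \<le> 1" "0 \<le> t" "s * t = R" "(1 + C1 * s\<^sup>2) * (1 + t powr q) \<le> 1 + e * R"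
      using R1(2) R by (metis min.boundedE)
    show ?thesis
    proof (rule combine)
      show "2 * \<pi> (elem x y + R *\<^sub>R elem a b) \<le>
          vnorm X (x + s *\<^sub>R a) * vnorm Y (y + t *\<^sub>R b) + vnorm X (x - s *\<^sub>R a) * vnorm Y (y - t *\<^sub>R b)"
        using norm_elem_perturb_le[OF mem, of s t] st(4) by simp
      show "vnorm X (x + s *\<^sub>R a) + vnorm X (x - s *\<^sub>R a) \<le> 2 + C1 * s\<^sup>2"
        using C1(2) mem norms st by simp
      show "vnorm Y (y + t *\<^sub>R b) \<le> 1 + t powr q" "vnorm Y (y - t *\<^sub>R b) \<le> 1 + t powr q"
        using lp_norm_add_disjoint[of q y J b t] lp_norm_add_disjoint[of q y J b "- t"] mem norms disj st q
        by simp_all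
    qed (use C1 st in \<open>auto simp: lp_norm_nonneg\<close>)
  next
    assume disj: "\<forall>i. x i = 0 \<or> a i = 0"
    obtain s t where st: "0 \<le> s" "s \<le> 1" "0 \<le> t" "s * t = R" "(1 + C2 * s\<^sup>2) * (1 + t powr p) \<le> 1 + e * R"
      using R2(2) R by (metis min.boundedE)
    show ?thesis
    proof (rule combine)
      show "2 * \<pi> (elem x y + R *\<^sub>R elem a b) \<le>
          vnorm Y (y + s *\<^sub>R b) * vnorm X (x + t *\<^sub>R a) + vnorm Y (y - s *\<^sub>R b) * vnorm X (x - t *\<^sub>R a)"
        using norm_elem_perturb_le[OF mem, of t s] st(4) by (simp add: mult.commute)
      show "vnorm Y (y + s *\<^sub>R b) + vnorm Y (y - s *\<^sub>R b) \<le> 2 + C2 * s\<^sup>2"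
        using C2(2) mem norms st by simp
      show "vnorm X (x + t *\<^sub>R a) \<le> 1 + t powr p" "vnorm X (x - t *\<^sub>R a) \<le> 1 + t powr p"
        using lp_norm_add_disjoint[of p x I a t] lp_norm_add_disjoint[of p x I a "- t"] mem norms disj st p
        by simp_all
    qed (use C2 st in \<open>auto simp: lp_norm_nonneg\<close>)
  qed
  then show ?thesis
    using R1(1) R2(1) by (intro exI[of _ "min R1 R2"]) auto
qed

text \<open>One set \<open>F\<close> or \<open>G\<close> serves both lists entirely, so the pairs
  allowed in each list form sets \<open>Z\<close> and \<open>U\<close> closed under scaling of the
  factors, as in \<open>norm_T_perturb_le\<close>.\<close>

definition separated :: "(('i \<Rightarrow> real) \<times> ('j \<Rightarrow> real)) list \<Rightarrow> (('i \<Rightarrow> real) \<times> ('j \<Rightarrow> real)) list \<Rightarrow> bool" where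
  "separated zs us \<longleftrightarrow>
    (\<exists>F. (\<forall>(x, y)\<in>set zs. \<forall>i. i \<notin> F \<longrightarrow> x i = 0) \<and> (\<forall>(a, b)\<in>set us. \<forall>i\<in>F. a i = 0)) \<or>
    (\<exists>G. (\<forall>(x, y)\<in>set zs. \<forall>j. j \<notin> G \<longrightarrow> y j = 0) \<and> (\<forall>(a, b)\<in>set us. \<forall>j\<in>G. b j = 0))"

text \<open>\<open>norm_T_perturb_le\<close> is applied with both weights equal to \<open>m\<close>;
  homogeneity then cancels one factor \<open>m\<close>.\<close>

lemma list_perturbation:
  assumes e: "0 < e"
  shows "\<exists>R. 0 < R \<and> R \<le> 1 \<and> (\<forall>zs\<in>pairs. \<forall>us\<in>pairs. \<forall>m>0. separated zs us \<longrightarrow>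
    weight zs \<le> m \<longrightarrow> weight us \<le> m \<longrightarrow> \<pi> (T zs + R *\<^sub>R T us) \<le> m * (1 + e * R))"
proof -
  obtain R0 where R0: "0 < R0" "\<forall>R. 0 < R \<longrightarrow> R \<le> R0 \<longrightarrow>
    (\<forall>x\<in>vcarrier X. \<forall>a\<in>vcarrier X. \<forall>y\<in>vcarrier Y. \<forall>b\<in>vcarrier Y.
      vnorm X x \<le> 1 \<longrightarrow> vnorm X a \<le> 1 \<longrightarrow> vnorm Y y \<le> 1 \<longrightarrow> vnorm Y b \<le> 1 \<longrightarrow>
      (\<forall>i. x i = 0 \<or> a i = 0) \<or> (\<forall>j. y j = 0 \<or> b j = 0) \<longrightarrow> \<pi> (elem x y + R *\<^sub>R elem a b) \<le> 1 + e * R)"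
    using elementary_perturbation[OF e] by blast
  define R where "R = min 1 R0"
  have R: "0 < R" "R \<le> 1" "R \<le> R0" using R0(1) by (auto simp: R_def)
  have elementary: "\<pi> (elem x y + R *\<^sub>R elem a b) \<le> 1 + e * R"
    if "x \<in> vcarrier X" "a \<in> vcarrier X" "y \<in> vcarrier Y" "b \<in> vcarrier Y"
      "vnorm X x \<le> 1" "vnorm X a \<le> 1" "vnorm Y y \<le> 1" "vnorm Y b \<le> 1"
      "(\<forall>i. x i = 0 \<or> a i = 0) \<or> (\<forall>j. y j = 0 \<or> b j = 0)" for x y a b
    using R0(2) R that by blast
  have rescale: "\<pi> (T zs + R *\<^sub>R T us) \<le> m * (1 + e * R)"
    if "\<pi> (m *\<^sub>R T zs + (R * m) *\<^sub>R T us) \<le> m * m * (1 + e * R)" "0 < m" "zs \<in> pairs" "us \<in> pairs" for m zs us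
  proof -
    have "m *\<^sub>R T zs + (R * m) *\<^sub>R T us = m *\<^sub>R (T zs + R *\<^sub>R T us)"
      by (simp add: scaleR_add_right mult.commute)
    then have "m * \<pi> (T zs + R *\<^sub>R T us) \<le> m * (m * (1 + e * R))"
      using that A.scale[OF A.add_mem[OF T_mem A.scale_mem[OF T_mem]], of zs us m R] by simp
    then show ?thesis using that(2) by simp
  qed
  show ?thesis
  proof (intro exI[of _ R] conjI R(1,2) ballI allI impI)
    fix zs us and m :: real
    assume pairs: "zs \<in> pairs" "us \<in> pairs" and m: "0 < m" "weight zs \<le> m" "weight us \<le> m"
      and "separated zs us"
    from \<open>separated zs us\<close> show "\<pi> (T zs + R *\<^sub>R T us) \<le> m * (1 + e * R)"
      unfolding separated_def
    proof (elim disjE exE)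
      fix F
      assume supp: "(\<forall>(x, y)\<in>set zs. \<forall>i. i \<notin> F \<longrightarrow> x i = 0) \<and> (\<forall>(a, b)\<in>set us. \<forall>i\<in>F. a i = 0)"
      have "\<pi> (m *\<^sub>R T zs + (R * m) *\<^sub>R T us) \<le> m * m * (1 + e * R)"
      proof (rule norm_T_perturb_le[where Z = "{(x, y) \<in> vcarrier X \<times> vcarrier Y. \<forall>i. i \<notin> F \<longrightarrow> x i = 0}"
            and U = "{(a, b) \<in> vcarrier X \<times> vcarrier Y. \<forall>i\<in>F. a i = 0}"])
        show "set zs \<subseteq> {(x, y) \<in> vcarrier X \<times> vcarrier Y. \<forall>i. i \<notin> F \<longrightarrow> x i = 0}"
          "set us \<subseteq> {(a, b) \<in> vcarrier X \<times> vcarrier Y. \<forall>i\<in>F. a i = 0}"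
          using pairs supp by (auto simp: pairs_def)
        fix x y a b
        assume "(x, y) \<in> {(x, y) \<in> vcarrier X \<times> vcarrier Y. \<forall>i. i \<notin> F \<longrightarrow> x i = 0}"
          "(a, b) \<in> {(a, b) \<in> vcarrier X \<times> vcarrier Y. \<forall>i\<in>F. a i = 0}"
          and norms: "vnorm X x \<le> 1" "vnorm Y y \<le> 1" "vnorm X a \<le> 1" "vnorm Y b \<le> 1"
        then show "\<pi> (elem x y + R *\<^sub>R elem a b) \<le> 1 + e * R"
          by (intro elementary) auto
      qed (use R e m in \<open>auto simp: X_mem(1) Y_mem(1)\<close>)
      then show ?thesis
        using m pairs by (intro rescale)
    next
      fix G
      assume supp: "(\<forall>(x, y)\<in>set zs. \<forall>j. j \<notin> G \<longrightarrow> y j = 0) \<and> (\<forall>(a, b)\<in>set us. \<forall>j\<in>G. b j = 0)"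
      have "\<pi> (m *\<^sub>R T zs + (R * m) *\<^sub>R T us) \<le> m * m * (1 + e * R)"
      proof (rule norm_T_perturb_le[where Z = "{(x, y) \<in> vcarrier X \<times> vcarrier Y. \<forall>j. j \<notin> G \<longrightarrow> y j = 0}"
            and U = "{(a, b) \<in> vcarrier X \<times> vcarrier Y. \<forall>j\<in>G. b j = 0}"])
        show "set zs \<subseteq> {(x, y) \<in> vcarrier X \<times> vcarrier Y. \<forall>j. j \<notin> G \<longrightarrow> y j = 0}"
          "set us \<subseteq> {(a, b) \<in> vcarrier X \<times> vcarrier Y. \<forall>j\<in>G. b j = 0}"
          using pairs supp by (auto simp: pairs_def)
        fix x y a b
        assume "(x, y) \<in> {(x, y) \<in> vcarrier X \<times> vcarrier Y. \<forall>j. j \<notin> G \<longrightarrow> y j = 0}"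
          "(a, b) \<in> {(a, b) \<in> vcarrier X \<times> vcarrier Y. \<forall>j\<in>G. b j = 0}"
          and norms: "vnorm X x \<le> 1" "vnorm Y y \<le> 1" "vnorm X a \<le> 1" "vnorm Y b \<le> 1"
        then show "\<pi> (elem x y + R *\<^sub>R elem a b) \<le> 1 + e * R"
          by (intro elementary) auto
      qed (use R e m in \<open>auto simp: X_mem(1) Y_mem(1)\<close>)
      then show ?thesis
        using m pairs by (intro rescale)
    qed
  qed
qed

section \<open>Splitting a tensor along a finite rectangle\<close>

text \<open>With truncations P to \<open>F\<close> and Q to \<open>G\<close>, the splitting is
  \<open>x \<otimes> y = P x \<otimes> Q y + (x - P x) \<otimes> Q y + x \<otimes> (y - Q
  y)\<close>. The last two summands are separated from every corner, one through each
  factor.\<close>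

definition corner :: "'i set \<Rightarrow> 'j set \<Rightarrow> (('i \<Rightarrow> real) \<times> ('j \<Rightarrow> real)) list \<Rightarrow> (('i \<Rightarrow> real) \<times> ('j \<Rightarrow> real)) list" where
  "corner F G = map (\<lambda>(x, y). (trunc F x, trunc G y))"

definition left_tail :: "'i set \<Rightarrow> 'j set \<Rightarrow> (('i \<Rightarrow> real) \<times> ('j \<Rightarrow> real)) list \<Rightarrow> (('i \<Rightarrow> real) \<times> ('j \<Rightarrow> real)) list" where
  "left_tail F G = map (\<lambda>(x, y). (x - trunc F x, trunc G y))"

definition right_tail :: "'j set \<Rightarrow> (('i \<Rightarrow> real) \<times> ('j \<Rightarrow> real)) list \<Rightarrow> (('i \<Rightarrow> real) \<times> ('j \<Rightarrow> real)) list" where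
  "right_tail G = map (\<lambda>(x, y). (x, y - trunc G y))"

lemmas list_parts = corner_def left_tail_def right_tail_def

lemma X_trunc: "x \<in> vcarrier X \<Longrightarrow> trunc F x \<in> vcarrier X" "x \<in> vcarrier X \<Longrightarrow> x - trunc F x \<in> vcarrier X"
    "x \<in> vcarrier X \<Longrightarrow> vnorm X (trunc F x) \<le> vnorm X x" "x \<in> vcarrier X \<Longrightarrow> vnorm X (x - trunc F x) \<le> vnorm X x"
  using p by (simp_all add: trunc_lp(1) lp_norm_trunc_le del: minus_apply)

lemma Y_trunc: "y \<in> vcarrier Y \<Longrightarrow> trunc G y \<in> vcarrier Y" "y \<in> vcarrier Y \<Longrightarrow> y - trunc G y \<in> vcarrier Y"
    "y \<in> vcarrier Y \<Longrightarrow> vnorm Y (trunc G y) \<le> vnorm Y y" "y \<in> vcarrier Y \<Longrightarrow> vnorm Y (y - trunc G y) \<le> vnorm Y y"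
  using q by (simp_all add: trunc_lp(1) lp_norm_trunc_le del: minus_apply)

lemma parts_pairs:
  assumes "zs \<in> pairs"
  shows "corner F G zs \<in> pairs" "left_tail F G zs \<in> pairs" "right_tail G zs \<in> pairs"
  using assms by (induction zs) (auto simp: list_parts X_trunc Y_trunc)

lemma T_parts:
  assumes "zs \<in> pairs"
  shows "T zs = T (corner F G zs) + T (left_tail F G zs) + T (right_tail G zs)"
  using assms
proof (induction zs)
  case (Cons z zs)
  obtain x y where z: "z = (x, y)" by (cases z)
  have "x \<in> vcarrier X" "y \<in> vcarrier Y" using Cons.prems by (auto simp: z)
  then have "elem x y = elem (trunc F x) (trunc G y) + elem (x - trunc F x) (trunc G y) + elem x (y - trunc G y)"
    by (simp add: elem_diff X_trunc Y_trunc)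
  then show ?case
    using Cons by (simp add: z list_parts add_ac del: plus_fun_apply minus_apply)
qed (simp add: list_parts)

lemma weight_parts:
  assumes "zs \<in> pairs"
  shows "weight (corner F G zs) \<le> weight zs" "weight (left_tail F G zs) \<le> weight zs"
    "weight (right_tail G zs) \<le> weight zs"
  unfolding weight_def list_parts map_map using assms
  by (intro sum_list_mono; auto simp: pairs_def X_trunc Y_trunc X_norm_nonneg Y_norm_nonneg
      simp del: minus_apply intro!: mult_mono mult_left_mono)+

lemma small_left_tail:
  assumes "zs \<in> pairs" "0 < \<eta>"
  obtains F where "finite F" "F \<subseteq> I" "\<And>G. weight (left_tail F G zs) \<le> \<eta>"
proof -
  \<comment> \<open>\<open>D\<close> leaves \<open>y\<close> untruncated and so bounds the weight
    for every \<open>G\<close> at once; \<open>F\<close> can be fixed before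
    \<open>G\<close>.\<close>
  define D where "D F = (\<Sum>(x, y)\<leftarrow>zs. vnorm X (x - trunc F x) * vnorm Y y)" for F
  have "(D \<longlongrightarrow> 0) (finite_subsets_at_top I)"
    using assms(1) unfolding D_def
  proof (induction zs)
    case (Cons z zs)
    obtain x y where z: "z = (x, y)" by (cases z)
    have "((\<lambda>F. vnorm X (x - trunc F x)) \<longlongrightarrow> 0) (finite_subsets_at_top I)"
      using Cons.prems p by (intro lp_norm_diff_trunc_tendsto) (auto simp: z)
    then have "((\<lambda>F. vnorm X (x - trunc F x) * vnorm Y y + (\<Sum>(x, y)\<leftarrow>zs. vnorm X (x - trunc F x) * vnorm Y y)) \<longlongrightarrow> 0 * vnorm Y y + 0) (finite_subsets_at_top I)"
      using Cons by (intro tendsto_add tendsto_mult_right) (simp_all add: z del: minus_apply)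
    then show ?case by (simp add: z del: minus_apply)
  qed simp
  then have "\<forall>\<^sub>F F in finite_subsets_at_top I. D F < \<eta>"
    using assms(2) by (rule order_tendstoD)
  moreover have "\<forall>\<^sub>F F in finite_subsets_at_top I. finite F \<and> F \<subseteq> I"
    by (rule eventually_finite_subsets_at_top_weakI) simp
  ultimately have "\<forall>\<^sub>F F in finite_subsets_at_top I. D F < \<eta> \<and> finite F \<and> F \<subseteq> I"
    by (rule eventually_conj)
  then obtain F where F: "D F < \<eta>" "finite F" "F \<subseteq> I"
    using eventually_happens'[OF finite_subsets_at_top_neq_bot] by blast
  have "weight (left_tail F G zs) \<le> D F" for G
    unfolding weight_def left_tail_def D_def map_map using assms(1)
    by (intro sum_list_mono) (auto simp: pairs_def X_norm_nonneg Y_trunc simp del: minus_apply intro!: mult_left_mono)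
  then show thesis
    using that[OF F(2,3)] F(1) by (meson less_imp_le order_trans)
qed

lemma small_right_tail:
  assumes "zs \<in> pairs" "0 < \<eta>"
  obtains G where "finite G" "G \<subseteq> J" "weight (right_tail G zs) \<le> \<eta>"
proof -
  have "((\<lambda>G. weight (right_tail G zs)) \<longlongrightarrow> 0) (finite_subsets_at_top J)"
    using assms(1)
  proof (induction zs)
    case (Cons z zs)
    obtain x y where z: "z = (x, y)" by (cases z)
    have "((\<lambda>G. vnorm Y (y - trunc G y)) \<longlongrightarrow> 0) (finite_subsets_at_top J)"
      using Cons.prems q by (intro lp_norm_diff_trunc_tendsto) (auto simp: z)
    then have "((\<lambda>G. vnorm X x * vnorm Y (y - trunc G y) + weight (right_tail G zs)) \<longlongrightarrow> vnorm X x * 0 + 0) (finite_subsets_at_top J)"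
      using Cons by (intro tendsto_add tendsto_mult_left) (simp_all add: z del: minus_apply)
    then show ?case by (simp add: z right_tail_def del: minus_apply)
  qed (simp add: right_tail_def)
  then have "\<forall>\<^sub>F G in finite_subsets_at_top J. weight (right_tail G zs) < \<eta>"
    using assms(2) by (rule order_tendstoD)
  moreover have "\<forall>\<^sub>F G in finite_subsets_at_top J. finite G \<and> G \<subseteq> J"
    by (rule eventually_finite_subsets_at_top_weakI) simp
  ultimately have "\<forall>\<^sub>F G in finite_subsets_at_top J. weight (right_tail G zs) < \<eta> \<and> finite G \<and> G \<subseteq> J"
    by (rule eventually_conj)
  then obtain G where "weight (right_tail G zs) < \<eta>" "finite G" "G \<subseteq> J"
    using eventually_happens'[OF finite_subsets_at_top_neq_bot] by blast
  then show thesis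
    using that[of G] by simp
qed

text \<open>A coordinate of \<open>x \<otimes> y\<close> is at most the product of the norms, so the
  coefficients are bounded by the weight, and corners of bounded weight over fixed \<open>F\<close>
  and \<open>G\<close> are covered by \<open>finite_net\<close>.\<close>

lemma corner_coordinates:
  assumes "zs \<in> pairs" "finite F" "F \<subseteq> I" "finite G" "G \<subseteq> J"
  shows "\<exists>c. (\<forall>k. \<bar>c k\<bar> \<le> weight zs) \<and>
    T (corner F G zs) = (\<Sum>k\<in>F \<times> G. c k *\<^sub>R elem (unit_vec (fst k)) (unit_vec (snd k)))"
  using assms(1)
proof (induction zs)
  case Nil
  show ?case by (intro exI[of _ "\<lambda>_. 0"]) (simp add: corner_def)
next
  case (Cons z zs)
  obtain x y where z: "z = (x, y)" by (cases z)
  have xy: "x \<in> vcarrier X" "y \<in> vcarrier Y" using Cons.prems by (auto simp: z)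
  obtain c where c: "\<And>k. \<bar>c k\<bar> \<le> weight zs"
    "T (corner F G zs) = (\<Sum>k\<in>F \<times> G. c k *\<^sub>R elem (unit_vec (fst k)) (unit_vec (snd k)))"
    using Cons.IH Cons.prems unfolding z pairs_simps by blast
  have units: "\<And>i. i \<in> F \<Longrightarrow> unit_vec i \<in> vcarrier X" "\<And>j. j \<in> G \<Longrightarrow> unit_vec j \<in> vcarrier Y"
    using assms p q by (auto intro!: unit_vec_lp)
  have "elem (trunc F x) (trunc G y) = (\<Sum>i\<in>F. elem (x i *\<^sub>R unit_vec i) (trunc G y))"
    unfolding trunc_eq_sum[OF assms(2)] using units assms(2) xy
    by (intro elem_sum X_mem(1) Y_trunc)
  also have "\<dots> = (\<Sum>i\<in>F. \<Sum>j\<in>G. elem (x i *\<^sub>R unit_vec i) (y j *\<^sub>R unit_vec j))"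
    unfolding trunc_eq_sum[OF assms(4)] using units assms(4)
    by (intro sum.cong refl elem_sum_right X_mem(1) Y_mem(1))
  also have "\<dots> = (\<Sum>i\<in>F. \<Sum>j\<in>G. (x i * y j) *\<^sub>R elem (unit_vec i) (unit_vec j))"
    using units by (intro sum.cong refl) (simp add: elem_scale X_mem(1) Y_mem(1) mult.commute)
  also have "\<dots> = (\<Sum>k\<in>F \<times> G. (x (fst k) * y (snd k)) *\<^sub>R elem (unit_vec (fst k)) (unit_vec (snd k)))"
    by (simp add: sum.cartesian_product case_prod_beta)
  finally have "T (corner F G (z # zs)) =
      (\<Sum>k\<in>F \<times> G. (x (fst k) * y (snd k) + c k) *\<^sub>R elem (unit_vec (fst k)) (unit_vec (snd k)))"
    using c(2) by (simp add: z corner_def scaleR_add_left sum.distrib)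
  moreover have "\<bar>x (fst k) * y (snd k) + c k\<bar> \<le> weight (z # zs)" for k
  proof -
    have "\<bar>x (fst k)\<bar> * \<bar>y (snd k)\<bar> \<le> vnorm X x * vnorm Y y"
      using xy p q by (intro mult_mono lp_abs_le_norm) (auto simp: X_norm_nonneg)
    then show ?thesis
      using c(1)[of k] abs_triangle_ineq[of "x (fst k) * y (snd k)" "c k"] by (simp add: z abs_mult)
  qed
  ultimately show ?case
    by (intro exI[of _ "\<lambda>k. x (fst k) * y (snd k) + c k"] conjI allI)
qed

text \<open>\<open>F\<close> and \<open>G\<close> are chosen for \<open>z\<close> alone. The corner
  of \<open>h\<close> is then approximated from a finite net, and each of the two tails of
  \<open>h\<close> is separated from the corner of \<open>z\<close>.\<close>

lemma asymptotically_smooth_alg_tensor: "A.asymptotically_smooth"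
  unfolding A.asymptotically_smooth_def
proof (intro allI impI)
  fix e :: real assume e: "0 < e"
  then have e4: "0 < e / 4" by simp
  obtain R where R: "0 < R" "R \<le> 1" and perturb: "\<forall>zs\<in>pairs. \<forall>us\<in>pairs. \<forall>m>0. separated zs us \<longrightarrow>
      weight zs \<le> m \<longrightarrow> weight us \<le> m \<longrightarrow> \<pi> (T zs + R *\<^sub>R T us) \<le> m * (1 + e / 4 * R)"
    using list_perturbation[OF e4] by blast
  \<comment> \<open>Each tail of \<open>h\<close> is added to one half of \<open>z'\<close>, so a
    perturbation of size \<open>R\<close> there amounts to \<open>R / 2\<close> overall.\<close>
  define r where "r = R / 2"
  \<comment> \<open>This solves \<open>\<eta> * 3 + \<eta> * (e * R) = e * R / 4\<close>: the
    approximation errors stay within \<open>e * R / 4\<close>, as does the perturbation term, and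
    together they make up \<open>e * r\<close>.\<close>
  define \<eta> where "\<eta> = e * R / (12 + 4 * (e * R))"
  have r: "0 < r" "r \<le> 1" using R by (auto simp: r_def)
  have eR: "0 < e * R" using e R by simp
  then have den: "0 < 12 + 4 * (e * R)" by linarith
  have \<eta>: "0 < \<eta>"
    unfolding \<eta>_def using eR den by (rule divide_pos_pos)
  have "\<eta> \<le> 1"
    unfolding \<eta>_def pos_divide_le_eq[OF den] mult_1 using eR by linarith
  note \<eta> = \<eta> this
  have "\<eta> * (12 + 4 * (e * R)) = e * R"
    unfolding \<eta>_def using den by (intro nonzero_eq_divide_eq[THEN iffD1, OF _ refl]) linarith
  then have \<eta>_eq: "\<eta> * 3 + \<eta> * (e * R) = e * R / 4"
    by (simp add: algebra_simps)
  show "\<exists>r>0. \<forall>z\<in>vcarrier (alg_tensor_pi X Y). \<pi> z \<le> 1 \<longrightarrow> (\<exists>K. A.smoothing_net e r z K)"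
  proof (intro exI[of _ r] conjI r(1) ballI impI)
    fix z assume z: "z \<in> vcarrier (alg_tensor_pi X Y)" "\<pi> z \<le> 1"
    obtain zs where zs: "zs \<in> pairs" "z = T zs" "weight zs < 1 + \<eta>"
      using norm_lessE[OF z(1), of "1 + \<eta>"] z(2) \<eta>(1) by auto
    obtain F where F: "finite F" "F \<subseteq> I" "\<And>G. weight (left_tail F G zs) \<le> \<eta> / 2"
      using small_left_tail[OF zs(1), of "\<eta> / 2"] \<eta>(1) by auto
    obtain G where G: "finite G" "G \<subseteq> J" "weight (right_tail G zs) \<le> \<eta> / 2"
      using small_right_tail[OF zs(1), of "\<eta> / 2"] \<eta>(1) by auto
    define z' where "z' = T (corner F G zs)"
    have z'_mem: "z' \<in> vcarrier (alg_tensor_pi X Y)"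
      unfolding z'_def by (intro T_mem parts_pairs zs)
    have "z - z' = T (left_tail F G zs @ right_tail G zs)"
      using T_parts[OF zs(1), of F G] by (simp add: zs z'_def del: plus_fun_apply minus_apply)
    then have "\<pi> (z - z') \<le> weight (left_tail F G zs @ right_tail G zs)"
      using norm_T_le[of "left_tail F G zs @ right_tail G zs"] zs(1)
      by (simp only: pairs_simps parts_pairs simp_thms)
    then have near: "\<pi> (z - z') \<le> \<eta>"
      using F(3)[of G] G(3) by (simp only: weight_simps)
    define v where "v k = elem (unit_vec (fst k)) (unit_vec (snd k))" for k :: "'i \<times> 'j"
    have v: "v k \<in> vcarrier (alg_tensor_pi X Y)" "\<pi> (v k) \<le> 1" if "k \<in> F \<times> G" for k
    proof -
      have k: "fst k \<in> I" "snd k \<in> J" using that F(2) G(2) by auto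
      then have mem: "unit_vec (fst k) \<in> vcarrier X" "unit_vec (snd k) \<in> vcarrier Y"
        using p q by (auto intro: unit_vec_lp)
      show "v k \<in> vcarrier (alg_tensor_pi X Y)" unfolding v_def by (rule elem_mem[OF mem])
      show "\<pi> (v k) \<le> 1"
        using norm_elem_le[OF mem] k p q by (simp add: v_def lp_norm_unit_vec)
    qed
    \<comment> \<open>The bound 2 covers the corner of any admissible \<open>h\<close>, whose
      representation will have weight below \<open>1 + \<eta> \<le> 2\<close>.\<close>
    obtain K where K: "finite K" "K \<subseteq> vcarrier (alg_tensor_pi X Y)"
      "\<forall>c. (\<forall>k\<in>F \<times> G. \<bar>c k\<bar> \<le> 2) \<longrightarrow> (\<exists>k\<in>K. \<pi> ((\<Sum>k\<in>F \<times> G. c k *\<^sub>R v k) - k) \<le> \<eta>)"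
      using A.finite_net[of "F \<times> G" \<eta> v 2] F(1) G(1) \<eta>(1) v by auto
    have "A.smoothing_net e r z K"
      unfolding A.smoothing_net_def
    proof (intro conjI K(1,2) ballI impI)
      fix h assume h: "h \<in> vcarrier (alg_tensor_pi X Y)" "\<pi> h \<le> 1"
      obtain hs where hs: "hs \<in> pairs" "h = T hs" "weight hs < 1 + \<eta>"
        using norm_lessE[OF h(1), of "1 + \<eta>"] h(2) \<eta>(1) by auto
      define k' where "k' = T (corner F G hs)"
      have k'_mem: "k' \<in> vcarrier (alg_tensor_pi X Y)"
        unfolding k'_def by (intro T_mem parts_pairs hs)
      obtain c where c: "\<And>k. \<bar>c k\<bar> \<le> weight hs" "k' = (\<Sum>k\<in>F \<times> G. c k *\<^sub>R v k)"
        using corner_coordinates[OF hs(1) F(1,2) G(1,2)] unfolding k'_def v_def by blast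
      have "\<bar>c k\<bar> \<le> 2" for k using c(1)[of k] hs(3) \<eta>(2) by simp
      then obtain k where k: "k \<in> K" "\<pi> (k' - k) \<le> \<eta>"
        using K(3) c(2) by blast
      have k_mem: "k \<in> vcarrier (alg_tensor_pi X Y)" using k(1) K(2) by blast
      \<comment> \<open>The sign \<open>\<sigma>\<close> is absorbed into the first factors of the
        tails, so both signs follow from the same estimate.\<close>
      have bound: "\<pi> (z + (\<sigma> * r) *\<^sub>R (h - k)) \<le> 1 + e * r" if \<sigma>: "\<bar>\<sigma>\<bar> = 1" for \<sigma>
      proof -
        define us where "us = map (\<lambda>(x, y). (\<sigma> *\<^sub>R x, y)) (left_tail F G hs)"
        define ws where "ws = map (\<lambda>(x, y). (\<sigma> *\<^sub>R x, y)) (right_tail G hs)"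
        have us: "us \<in> pairs" "T us = \<sigma> *\<^sub>R T (left_tail F G hs)" "weight us \<le> 1 + \<eta>"
          using scale_list[OF parts_pairs(2)[OF hs(1)], of \<sigma> F G] weight_parts(2)[OF hs(1), of F G] hs(3) \<sigma>
          by (simp_all add: us_def)
        have ws: "ws \<in> pairs" "T ws = \<sigma> *\<^sub>R T (right_tail G hs)" "weight ws \<le> 1 + \<eta>"
          using scale_list[OF parts_pairs(3)[OF hs(1)], of \<sigma> G] weight_parts(3)[OF hs(1), of G] hs(3) \<sigma>
          by (simp_all add: ws_def)
        have corner: "corner F G zs \<in> pairs" "weight (corner F G zs) \<le> 1 + \<eta>"
          using parts_pairs(1)[OF zs(1)] weight_parts(1)[OF zs(1), of F G] zs(3) by auto
        have "separated (corner F G zs) us" "separated (corner F G zs) ws"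
          unfolding separated_def us_def ws_def list_parts
          by (rule disjI1, rule exI[of _ F], force simp: trunc_def) (rule disjI2, rule exI[of _ G], force simp: trunc_def)
        then have left: "\<pi> (z' + R *\<^sub>R T us) \<le> (1 + \<eta>) * (1 + e / 4 * R)"
          and right: "\<pi> (z' + R *\<^sub>R T ws) \<le> (1 + \<eta>) * (1 + e / 4 * R)"
          unfolding z'_def using perturb corner us(1,3) ws(1,3) \<eta> by auto
        have mem: "z - z' \<in> vcarrier (alg_tensor_pi X Y)" "k' - k \<in> vcarrier (alg_tensor_pi X Y)"
          "z' + R *\<^sub>R T us \<in> vcarrier (alg_tensor_pi X Y)" "z' + R *\<^sub>R T ws \<in> vcarrier (alg_tensor_pi X Y)"
          by (rule A.diff_mem[OF z(1) z'_mem] A.diff_mem[OF k'_mem k_mem]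
              A.add_mem[OF z'_mem A.scale_mem[OF T_mem[OF us(1)]]]
              A.add_mem[OF z'_mem A.scale_mem[OF T_mem[OF ws(1)]]])+
        have h_eq: "h = k' + T (left_tail F G hs) + T (right_tail G hs)"
          unfolding k'_def hs(2) by (rule T_parts[OF hs(1)])
        \<comment> \<open>\<open>z'\<close> is divided equally between the two tails; the summands
          with \<open>z - z'\<close> and \<open>k' - k\<close> are small.\<close>
        have eq: "z + (\<sigma> * r) *\<^sub>R (h - k) = (z - z') + ((1 / 2) *\<^sub>R (z' + R *\<^sub>R T us) +
            ((1 / 2) *\<^sub>R (z' + R *\<^sub>R T ws) + (\<sigma> * r) *\<^sub>R (k' - k)))"
          unfolding h_eq us(2) ws(2) r_def by (auto simp: fun_eq_iff field_simps)
        have sum: "\<pi> ((z - z') + ((1 / 2) *\<^sub>R (z' + R *\<^sub>R T us) +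
            ((1 / 2) *\<^sub>R (z' + R *\<^sub>R T ws) + (\<sigma> * r) *\<^sub>R (k' - k)))) \<le>
            \<pi> (z - z') + (1 / 2 * \<pi> (z' + R *\<^sub>R T us) + (1 / 2 * \<pi> (z' + R *\<^sub>R T ws) + r * \<pi> (k' - k)))"
        proof -
          note s = A.scale_mem[OF mem(3), of "1 / 2"] A.scale_mem[OF mem(4), of "1 / 2"]
            A.scale_mem[OF mem(2), of "\<sigma> * r"]
          show ?thesis
            using A.triangle[OF mem(1) A.add_mem[OF s(1) A.add_mem[OF s(2,3)]]]
              A.triangle[OF s(1) A.add_mem[OF s(2,3)]] A.triangle[OF s(2,3)]
              A.scale[OF mem(3), of "1 / 2"] A.scale[OF mem(4), of "1 / 2"] A.scale[OF mem(2), of "\<sigma> * r"] \<sigma> r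
            by (simp add: abs_mult)
        qed
        have rk: "r * \<pi> (k' - k) \<le> 1 * \<eta>"
          using r k(2) A.N_nonneg[OF mem(2)] by (intro mult_mono) auto
        have "\<pi> (z + (\<sigma> * r) *\<^sub>R (h - k)) \<le> \<eta> + (1 + \<eta>) * (1 + e / 4 * R) + \<eta>"
          unfolding eq using sum rk near left right by linarith
        also have "\<dots> \<le> 1 + e * R / 4 + (\<eta> * 3 + \<eta> * (e * R))"
          using \<eta>(1) e R by (simp add: algebra_simps)
        also have "\<dots> = 1 + e * r"
          unfolding \<eta>_eq by (simp add: r_def)
        finally show ?thesis .
      qed
      have "\<pi> (z + r *\<^sub>R (h - k)) \<le> 1 + e * r"
        using bound[of 1] by simp
      moreover have "\<pi> (z - r *\<^sub>R (h - k)) \<le> 1 + e * r"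
        using bound[of "- 1"] by (simp only: mult_minus1 scaleR_minus_left add_uminus_conv_diff abs_minus abs_one)
      ultimately show "\<exists>k\<in>K. \<pi> (z + r *\<^sub>R (h - k)) \<le> 1 + e * r \<and> \<pi> (z - r *\<^sub>R (h - k)) \<le> 1 + e * r"
        using k(1) by blast
    qed
    then show "\<exists>K. A.smoothing_net e r z K" by blast
  qed
qed

end

theorem theorem2p5:
  fixes p q :: real and I :: "'i set" and J :: "'j set"
  assumes "2 < p" and "2 < q" and "I \<noteq> {}" and "J \<noteq> {}"
  shows "dual_weak_star_Kadec_Klee (proj_tensor (lp_space p I) (lp_space q J)) \<and>
         strongly_subdifferentiable_norm (proj_tensor (lp_space p I) (lp_space q J))"
proof -
  interpret lp_pair p q I J
    using assms by unfold_locales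
  show ?thesis
    unfolding proj_tensor_def
    using A.completion_dual_Kadec_Klee A.completion_strongly_subdifferentiable
      asymptotically_smooth_alg_tensor by blast
qed

end
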